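(* Let $\xi=(\xi_x)_{x\in\mathbb{Z}^2}$ be the auxiliary Gaussian Pickard random field of the two-dimensional Manhattan elastic dimer-monomer system, i.e. the homogeneous Gaussian random field with mean $\mu$ and covariance $\mathbf{cov}(\xi_x,\xi_y)=\rho_1^{|x_1-y_1|}\rho_2^{|x_2-y_2|}$, and let the sets $\Delta_N\subset\mathbb{Z}^2$, the random vectors $\Sigma_N=(\Sigma_{N,j})_{0\leq j\leq 2N}$ and the conditional product moment functions $R_N:\mathbb{R}^{2N+1}\to\mathbb{R}$, given by $R_N(\Sigma_N)=\mathbf{E}\big(\prod_{x\in\Delta_N}\xi_x\,\big|\,\Sigma_N\big)$, be as defined in the context. Then for any integer $N>0$, the function $R_N$ satisfies the recurrence equation $$R_N(\Sigma_N)=\mathbf{E}\big(R_{N-1}(\Sigma_{N-1})\,\big|\,\Sigma_N\big)\,(\mu+\Sigma_{N,0})(\mu+\Sigma_{N,2N})\prod_{k=0}^{N-1}(\mu+\Sigma_{N,2k+1}),$$ with the initial condition $R_0(s)=\mu+s$. Here, the conditional expectation is taken over the conditional probability distribution of $\Sigma_{N-1}$ given $\Sigma_N$, which is described as follows: $\Sigma_{N-1,2k-1}=\Sigma_{N,2k}$ for $1\leq k<N$, while the entries $\Sigma_{N-1,2k}$, $0\leq k<N$, are conditionally independent given $\Sigma_N$, with the conditional distribution of $\Sigma_{N-1,2k}$ given $\Sigma_N$ being Gaussian with mean $$\rho_2\Sigma_{N,2k}-\rho_1\rho_2\Sigma_{N,2k+1}+\rho_1\Sigma_{N,2k+2}$$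 and variance $(1-\rho_1^2)(1-\rho_2^2)$.
   Context: Parameters: $\beta>0$ is the inverse temperature, $V\in\mathbb{R}$ is the monomer energy, $\mu:=\mathrm{e}^{-\beta V}$; $\alpha_1,\alpha_2>0$ are the parameters of the Manhattan dimer potential $W(z)=\alpha_1|z_1|+\alpha_2|z_2|$ on $\mathbb{Z}^2$, and $\rho_k:=\mathrm{e}^{-\alpha_k\beta}\in(0,1)$ for $k=1,2$. The centered field is $\sigma_x:=\xi_x-\mu$, $x\in\mathbb{Z}^2$. Level sets: for $\ell\geq0$, $L_\ell:=\{(j,k)\in\mathbb{Z}^2:\ j\geq 0,\ k\geq 0,\ j+k=\ell\}$. For $N\geq0$, $$\Gamma_N:=\big(-(L_N\cup L_{N+1})\big)\setminus\{(0,-N-1),(-N-1,0)\},$$ which consists of $2N+1$ sites, and $\Delta_N:=\bigcup_{\ell=0}^N\Gamma_\ell$. In particular, $\Gamma_0=\Delta_0=\{(0,0)\}$. The sites of $\Gamma_N$ are numbered from $0$ to $2N$ in a zigzag manner as $(0,-N),(-1,-N),(-1,-N+1),\ldots,(-N+1,-1),(-N,-1),(-N,0)$, and $\Sigma_N=(\Sigma_{N,j})_{0\leq j\leq 2N}$ is the $(2N+1)$-dimensional Gaussian random vector of the values of $\sigma$ at these sites in this order. That is, $\Sigma_{N,2k}=\sigma_{(-k,\,-N+k)}$ for $0\leq k\leq N$ and $\Sigma_{N,2k+1}=\sigma_{(-k-1,\,-N+k)}$ for $0\leq k\leq N-1$. As usual, equalities between conditional expectations are understood almost surely. *)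

theory Defs
  imports "HOL-Probability.Probability"
begin

text \<open>Almost surely constant random variables count as (degenerate) Gaussian ones, so that the
  empty linear combination is allowed in the definition of a Gaussian field.\<close>

definition gaussian_rv :: "'a measure \<Rightarrow> ('a \<Rightarrow> real) \<Rightarrow> bool" where
  "gaussian_rv M X \<longleftrightarrow> X \<in> borel_measurable M \<and>
     ((\<exists>m s. 0 < s \<and> distributed M lborel X (normal_density m s)) \<or>
      (\<exists>m. AE \<omega> in M. X \<omega> = m))"

definition gaussian_field :: "'a measure \<Rightarrow> ('i \<Rightarrow> 'a \<Rightarrow> real) \<Rightarrow> bool" where
  "gaussian_field M \<xi> \<longleftrightarrow>
     (\<forall>S c. finite S \<longrightarrow> gaussian_rv M (\<lambda>\<omega>. \<Sum>x\<in>S. c x * \<xi> x \<omega>))"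

definition covariance :: "'a measure \<Rightarrow> ('a \<Rightarrow> real) \<Rightarrow> ('a \<Rightarrow> real) \<Rightarrow> real" where
  "covariance M X Y =
     integral\<^sup>L M (\<lambda>\<omega>. (X \<omega> - integral\<^sup>L M X) * (Y \<omega> - integral\<^sup>L M Y))"

text \<open>Homogeneity is not a separate clause: the law of a Gaussian field is determined by its mean
  and covariance, and here both are translation invariant.\<close>

definition pickard_field ::
  "'a measure \<Rightarrow> real \<Rightarrow> real \<Rightarrow> real \<Rightarrow> (int \<times> int \<Rightarrow> 'a \<Rightarrow> real) \<Rightarrow> bool" where
  "pickard_field M \<mu> \<rho>\<^sub>1 \<rho>\<^sub>2 \<xi> \<longleftrightarrow>
     gaussian_field M \<xi> \<and>
     (\<forall>x. integral\<^sup>L M (\<xi> x) = \<mu>) \<and>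
     (\<forall>x y. covariance M (\<xi> x) (\<xi> y) =
        \<rho>\<^sub>1 ^ nat \<bar>fst x - fst y\<bar> * \<rho>\<^sub>2 ^ nat \<bar>snd x - snd y\<bar>)"

definition cond_prob_ind :: "'a measure \<Rightarrow> 'a measure \<Rightarrow> 'a set \<Rightarrow> 'a \<Rightarrow> real" where
  "cond_prob_ind M F A = real_cond_exp M F (indicat_real A)"

text \<open>\<open>K\<close> is a regular version of the conditional distribution of \<open>X\<close> (with values in \<open>E\<close>)
  given \<open>F\<close>.\<close>

definition regular_cond_distr ::
  "'a measure \<Rightarrow> 'a measure \<Rightarrow> 'b measure \<Rightarrow> ('a \<Rightarrow> 'b) \<Rightarrow> ('a \<Rightarrow> 'b measure) \<Rightarrow> bool" where
  "regular_cond_distr M F E X K \<longleftrightarrow>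
     X \<in> M \<rightarrow>\<^sub>M E \<and>
     K \<in> F \<rightarrow>\<^sub>M prob_algebra E \<and>
     (\<forall>A\<in>sets E. AE \<omega> in M.
        cond_prob_ind M F (X -` A \<inter> space M) \<omega> = measure (K \<omega>) A)"

definition cond_indep_vars ::
  "'a measure \<Rightarrow> 'a measure \<Rightarrow> ('i \<Rightarrow> 'b measure) \<Rightarrow> ('i \<Rightarrow> 'a \<Rightarrow> 'b) \<Rightarrow> 'i set \<Rightarrow> bool" where
  "cond_indep_vars M F E X I \<longleftrightarrow>
     (\<forall>i\<in>I. X i \<in> M \<rightarrow>\<^sub>M E i) \<and>
     (\<forall>J B. J \<subseteq> I \<longrightarrow> J \<noteq> {} \<longrightarrow> finite J \<longrightarrow> (\<forall>j\<in>J. B j \<in> sets (E j)) \<longrightarrow>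
        (AE \<omega> in M. cond_prob_ind M F (\<Inter>j\<in>J. X j -` B j \<inter> space M) \<omega> =
           (\<Prod>j\<in>J. cond_prob_ind M F (X j -` B j \<inter> space M) \<omega>)))"

definition L :: "nat \<Rightarrow> (int \<times> int) set" where
  "L l = {(j, k). 0 \<le> j \<and> 0 \<le> k \<and> j + k = int l}"

definition \<Gamma> :: "nat \<Rightarrow> (int \<times> int) set" where
  "\<Gamma> N = uminus ` (L N \<union> L (N + 1)) - {(0, - int N - 1), (- int N - 1, 0)}"

definition \<Delta> :: "nat \<Rightarrow> (int \<times> int) set" where
  "\<Delta> N = (\<Union>l\<le>N. \<Gamma> l)"

definition zigzag :: "nat \<Rightarrow> nat \<Rightarrow> int \<times> int" where
  "zigzag N j = (let k = int (j div 2) in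
     if even j then (- k, - int N + k) else (- k - 1, - int N + k))"

text \<open>The Euclidean space of dimension \<open>2N + 1\<close> is the product space of functions on \<open>{..2N}\<close>
  (undefined outside this set), since the dimension varies with \<open>N\<close>.\<close>

abbreviation zspace :: "nat \<Rightarrow> (nat \<Rightarrow> real) measure" where
  "zspace N \<equiv> Pi\<^sub>M {..2 * N} (\<lambda>_. borel)"

definition zvec :: "real \<Rightarrow> (int \<times> int \<Rightarrow> 'a \<Rightarrow> real) \<Rightarrow> nat \<Rightarrow> 'a \<Rightarrow> nat \<Rightarrow> real" where
  "zvec \<mu> \<xi> N \<omega> = (\<lambda>j\<in>{..2 * N}. \<xi> (zigzag N j) \<omega> - \<mu>)"

definition zalg :: "'a measure \<Rightarrow> real \<Rightarrow> (int \<times> int \<Rightarrow> 'a \<Rightarrow> real) \<Rightarrow> nat \<Rightarrow> 'a measure" where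
  "zalg M \<mu> \<xi> N = vimage_algebra (space M) (zvec \<mu> \<xi> N) (zspace N)"

text \<open>A function with the following property is unique only up to equality almost everywhere.\<close>

definition cond_moment_function ::
  "'a measure \<Rightarrow> real \<Rightarrow> (int \<times> int \<Rightarrow> 'a \<Rightarrow> real) \<Rightarrow> nat \<Rightarrow> ((nat \<Rightarrow> real) \<Rightarrow> real) \<Rightarrow> bool" where
  "cond_moment_function M \<mu> \<xi> N r \<longleftrightarrow>
     r \<in> borel_measurable (zspace N) \<and>
     (AE \<omega> in M. r (zvec \<mu> \<xi> N \<omega>) =
        real_cond_exp M (zalg M \<mu> \<xi> N) (\<lambda>\<omega>. \<Prod>x\<in>\<Delta> N. \<xi> x \<omega>) \<omega>)"

definition cond_gauss :: "real \<Rightarrow> real \<Rightarrow> (nat \<Rightarrow> real) \<Rightarrow> nat \<Rightarrow> real measure" where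
  "cond_gauss \<rho>\<^sub>1 \<rho>\<^sub>2 s k = density lborel
     (normal_density (\<rho>\<^sub>2 * s (2 * k) - \<rho>\<^sub>1 * \<rho>\<^sub>2 * s (2 * k + 1) + \<rho>\<^sub>1 * s (2 * k + 2))
        (sqrt ((1 - \<rho>\<^sub>1\<^sup>2) * (1 - \<rho>\<^sub>2\<^sup>2))))"

text \<open>The law on \<open>zspace (N - 1)\<close> given the value \<open>s\<close> of the vector at level \<open>N > 0\<close>: the entry
  with odd index \<open>2k - 1\<close> is frozen at \<open>s\<^sub>2\<^sub>k\<close>, all entries are independent.\<close>

definition transition_law :: "real \<Rightarrow> real \<Rightarrow> nat \<Rightarrow> (nat \<Rightarrow> real) \<Rightarrow> (nat \<Rightarrow> real) measure" where
  "transition_law \<rho>\<^sub>1 \<rho>\<^sub>2 N s = Pi\<^sub>M {..2 * (N - 1)}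
     (\<lambda>j. if even j then cond_gauss \<rho>\<^sub>1 \<rho>\<^sub>2 s (j div 2) else return borel (s (j + 1)))"

end

theory Submission
  imports Defs
begin

text \<open>
  Why the recurrence holds. The covariance of the field is a product of two one-dimensional
  geometric covariances, so the mixed difference
  \<open>innov (a, b) = \<sigma> (a, b) - \<rho>\<^sub>1 \<sigma> (a - 1, b) - \<rho>\<^sub>2 \<sigma> (a, b - 1) + \<rho>\<^sub>1 \<rho>\<^sub>2 \<sigma> (a - 1, b - 1)\<close>
  applies the innovation filter of a stationary first-order autoregression in each coordinate. It is
  therefore orthogonal to every \<open>\<sigma> (c, d)\<close> with \<open>c < a\<close> or \<open>d < b\<close>; the innovations are orthogonal to
  each other and have variance \<open>(1 - \<rho>\<^sub>1\<^sup>2) (1 - \<rho>\<^sub>2\<^sup>2)\<close>. In a Gaussian space orthogonal means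
  independent.

  An even entry of the level \<open>n\<close> vector is an innovation plus the combination of three neighbouring
  entries of the level \<open>n + 1\<close> vector given by the filter, and an odd entry is an entry of the level
  \<open>n + 1\<close> vector (\<open>zvec_eq_cond_mean_add_noise\<close>). All these innovations are independent of the level
  \<open>n + 1\<close> vector, whose sites have smaller coordinate sum. Conditioning a function of two independent
  variables on one of them amounts to freezing that variable and averaging over the other
  (\<open>real_cond_exp_freeze\<close>), which gives the conditional law and the conditional independence.

  For the recurrence itself, solving the filter equation for \<open>\<sigma>\<close> expresses the whole field on \<open>\<Delta> n\<close> as
  a function of the level \<open>n\<close> vector and of innovations with larger coordinate sum, which are
  independent of the vectors at the levels \<open>n\<close> and \<open>n + 1\<close> together. Hence, given the level \<open>n\<close> vector,
  the level \<open>n + 1\<close> vector carries no further information about the product over \<open>\<Delta> n\<close>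
  (\<open>zvec_markov\<close>). The sites of \<open>\<Delta> (n + 1)\<close> outside \<open>\<Delta> n\<close> are the two ends and the odd entries of the
  level \<open>n + 1\<close> vector, so their factors leave the conditional expectation (\<open>prod_\<Delta>_Suc\<close>,
  \<open>cond_moment_recurrence\<close>).

  That orthogonality implies independence rests on the uniqueness theorem for characteristic functions
  in several dimensions, reduced here to Levy's theorem on the real line by treating one coordinate
  at a time, with the other exponentials kept as a bounded weight.
\<close>

section \<open>Characteristic functions with a bounded weight\<close>

context prob_space
begin

text \<open>
  For \<open>D\<close> bounded by \<open>C\<close>, the weight \<open>1 + D / C\<close> is nonnegative and has mean \<open>1\<close> (the hypothesis at
  \<open>t = 0\<close>), so it is a probability density. Under this density \<open>Y\<close> has the same characteristic function
  as under \<open>M\<close>, hence the same law; the difference of the two laws is the claim. This is how a signed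
  measure is brought within the scope of Levy's theorem.
\<close>

lemma integral_indicator_eq_0_if_weighted_char_eq_0_real:
  fixes D Y :: "'a \<Rightarrow> real"
  assumes D [measurable]: "random_variable borel D" and bound: "\<And>x. \<bar>D x\<bar> \<le> C" and "C > 0"
    and Y [measurable]: "random_variable borel Y"
    and zero: "\<And>t. expectation (\<lambda>x. complex_of_real (D x) * iexp (t * Y x)) = 0"
    and A [measurable]: "A \<in> sets borel"
  shows "expectation (\<lambda>x. D x * indicator A (Y x)) = 0"
proof -
  define w where "w = (\<lambda>x. 1 + D x / C)"
  have w [measurable]: "w \<in> borel_measurable M" unfolding w_def by measurable
  have w_nonneg: "0 \<le> w x" and w_le: "w x \<le> 2" for x
    using bound[of x] \<open>C > 0\<close> by (auto simp: w_def field_simps abs_le_iff)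
  have int_D: "integrable M D"
    by (rule integrable_const_bound[of _ C]) (use bound in auto)
  have int_w: "integrable M w"
    unfolding w_def using int_D by auto
  have int_w_bdd: "integrable M (\<lambda>x. w x *\<^sub>R f x)"
    if [measurable]: "f \<in> borel_measurable M" and "\<And>x. norm (f x) \<le> 1"
      for f :: "'a \<Rightarrow> 'b::{banach, second_countable_topology}"
    by (rule integrable_const_bound[of _ 2])
      (use that w_nonneg w_le mult_mono[OF w_le, of "norm (f _)" 1] in auto)
  have int_D_bdd: "integrable M (\<lambda>x. D x *\<^sub>R f x)"
    if [measurable]: "f \<in> borel_measurable M" and "\<And>x. norm (f x) \<le> 1"
      for f :: "'a \<Rightarrow> 'b::{banach, second_countable_topology}"
    by (rule integrable_const_bound[of _ C])
      (use that bound mult_mono[OF bound, of "norm (f _)" 1] \<open>C > 0\<close> in auto)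
  have expectation_w: "expectation (\<lambda>x. w x *\<^sub>R f x) = expectation f + expectation (\<lambda>x. D x *\<^sub>R f x) /\<^sub>R C"
    if [measurable]: "f \<in> borel_measurable M" and "\<And>x. norm (f x) \<le> 1"
      for f :: "'a \<Rightarrow> 'b::{banach, second_countable_topology}"
  proof -
    have "integrable M f"
      by (rule integrable_const_bound[of _ 1]) (use that in auto)
    then have "expectation (\<lambda>x. f x + (D x *\<^sub>R f x) /\<^sub>R C) = expectation f + expectation (\<lambda>x. D x *\<^sub>R f x) /\<^sub>R C"
      using int_D_bdd[OF that]
      by (subst Bochner_Integration.integral_add) (auto simp del: scaleR_scaleR)
    then show ?thesis
      by (simp add: w_def scaleR_add_left divide_inverse mult.commute)
  qed
  define P where "P = density M (\<lambda>x. ennreal (w x))"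
  have ED: "expectation D = 0"
    using zero[of 0] by simp
  have "emeasure P (space P) = (\<integral>\<^sup>+x. ennreal (w x) \<partial>M)"
    by (simp add: P_def emeasure_density)
  also have "\<dots> = ennreal (expectation w)"
    by (rule nn_integral_eq_integral) (use int_w w_nonneg in auto)
  also have "expectation w = 1"
    unfolding w_def using int_D ED by (simp add: prob_space)
  finally interpret P: prob_space P
    by (intro prob_spaceI) simp
  have YP [measurable]: "Y \<in> borel_measurable P" unfolding P_def by simp
  interpret D1: real_distribution "distr P borel Y" by (rule P.real_distribution_distr) simp
  interpret D2: real_distribution "distr M borel Y" by (rule real_distribution_distr) simp
  have "char (distr P borel Y) = char (distr M borel Y)"
  proof
    fix t
    have "char (distr P borel Y) t = expectation (\<lambda>x. w x *\<^sub>R iexp (t * Y x))"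
      by (simp add: char_def integral_distr P_def integral_density w_nonneg)
    also have "\<dots> = expectation (\<lambda>x. iexp (t * Y x)) + expectation (\<lambda>x. D x *\<^sub>R iexp (t * Y x)) /\<^sub>R C"
      by (rule expectation_w) auto
    also have "expectation (\<lambda>x. D x *\<^sub>R iexp (t * Y x)) = 0"
      using zero[of t] by (simp add: scaleR_conv_of_real)
    also have "expectation (\<lambda>x. iexp (t * Y x)) + 0 /\<^sub>R C = char (distr M borel Y) t"
      by (simp add: char_def integral_distr)
    finally show "char (distr P borel Y) t = char (distr M borel Y) t" .
  qed
  then have "distr P borel Y = distr M borel Y"
    by (intro Levy_uniqueness) unfold_locales
  note distr_eq = this
  have "expectation (\<lambda>x. w x *\<^sub>R indicator A (Y x)) = (\<integral>x. indicat_real A (Y x) \<partial>P)"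
    unfolding P_def by (rule integral_density[symmetric]) (use w_nonneg in auto)
  also have "\<dots> = (\<integral>y. indicat_real A y \<partial>distr P borel Y)"
    by (rule integral_distr[symmetric]) auto
  also have "\<dots> = (\<integral>y. indicat_real A y \<partial>distr M borel Y)"
    by (simp only: distr_eq)
  also have "\<dots> = (\<integral>x. indicat_real A (Y x) \<partial>M)"
    by (rule integral_distr) auto
  finally have "expectation (\<lambda>x. w x *\<^sub>R indicator A (Y x)) = expectation (\<lambda>x. indicat_real A (Y x))" .
  moreover have "expectation (\<lambda>x. w x *\<^sub>R indicator A (Y x)) =
      (expectation (\<lambda>x. indicator A (Y x)) + expectation (\<lambda>x. D x *\<^sub>R indicator A (Y x)) /\<^sub>R C :: real)"
    by (rule expectation_w) (auto simp: indicator_def)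
  ultimately show ?thesis
    using \<open>C > 0\<close> by simp
qed

lemma integrable_bounded_mult:
  fixes D f :: "'a \<Rightarrow> complex"
  assumes [measurable]: "random_variable borel D" "random_variable borel f"
    and "\<And>x. norm (D x) \<le> C" "\<And>x. norm (f x) \<le> 1"
  shows "integrable M (\<lambda>x. D x * f x)"
proof (rule integrable_const_bound[of _ C])
  show "AE x in M. norm (D x * f x) \<le> C"
  proof (rule AE_I2)
    fix x
    have "norm (D x) * norm (f x) \<le> C * 1"
      by (rule mult_mono) (use assms in \<open>auto intro: order_trans[OF norm_ge_zero]\<close>)
    then show "norm (D x * f x) \<le> C" by (simp add: norm_mult)
  qed
qed simp

text \<open>
  The real case applies to the real and imaginary parts: the hypothesis for all \<open>t\<close> includes that for
  \<open>- t\<close>, and conjugation then gives it for \<open>cnj D\<close>.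
\<close>

lemma integral_indicator_eq_0_if_weighted_char_eq_0:
  fixes D :: "'a \<Rightarrow> complex" and Y :: "'a \<Rightarrow> real"
  assumes D [measurable]: "random_variable borel D" and bound: "\<And>x. norm (D x) \<le> C" and "C > 0"
    and Y [measurable]: "random_variable borel Y"
    and zero: "\<And>t. expectation (\<lambda>x. D x * iexp (t * Y x)) = 0"
    and A [measurable]: "A \<in> sets borel"
  shows "expectation (\<lambda>x. D x * indicator A (Y x)) = 0"
proof -
  have zero_cnj: "expectation (\<lambda>x. cnj (D x) * iexp (t * Y x)) = 0" for t
  proof -
    have "expectation (\<lambda>x. cnj (D x) * iexp (t * Y x)) = expectation (\<lambda>x. cnj (D x * iexp (- t * Y x)))"
      by (simp add: exp_cnj)
    also have "\<dots> = cnj (expectation (\<lambda>x. D x * iexp (- t * Y x)))"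
      by (rule Bochner_Integration.integral_cnj)
    finally show ?thesis using zero[of "- t"] by simp
  qed
  have [measurable]: "random_variable borel (\<lambda>x. cnj (D x))"
    by (rule borel_measurable_continuous_on[OF continuous_on_cnj[OF continuous_on_id] D])
  have int1: "integrable M (\<lambda>x. D x * iexp (t * Y x))" for t
    by (rule integrable_bounded_mult[where C = C]) (use bound in simp_all)
  have int2: "integrable M (\<lambda>x. cnj (D x) * iexp (t * Y x))" for t
    by (rule integrable_bounded_mult[where C = C]) (use bound in simp_all)
  have "expectation (\<lambda>x. complex_of_real (Re (D x)) * iexp (t * Y x)) = 0" for t
  proof -
    have "expectation (\<lambda>x. complex_of_real (Re (D x)) * iexp (t * Y x)) =
       expectation (\<lambda>x. (D x * iexp (t * Y x) + cnj (D x) * iexp (t * Y x)) / 2)"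
      by (intro Bochner_Integration.integral_cong refl)
        (simp add: complex_add_cnj flip: distrib_right)
    then show ?thesis using int1[of t] int2[of t] zero[of t] zero_cnj[of t] by simp
  qed
  then have Re_0: "expectation (\<lambda>x. Re (D x) * indicator A (Y x)) = 0"
    by (intro integral_indicator_eq_0_if_weighted_char_eq_0_real[where C = C])
      (use order_trans[OF abs_Re_le_cmod bound] \<open>C > 0\<close> in simp_all)
  have "expectation (\<lambda>x. complex_of_real (Im (D x)) * iexp (t * Y x)) = 0" for t
  proof -
    have "expectation (\<lambda>x. complex_of_real (Im (D x)) * iexp (t * Y x)) =
       expectation (\<lambda>x. (D x * iexp (t * Y x) - cnj (D x) * iexp (t * Y x)) / (2 * \<i>))"
    proof (intro Bochner_Integration.integral_cong refl)
      fix x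
      have eq: "D x * iexp (t * Y x) - cnj (D x) * iexp (t * Y x) = complex_of_real (Im (D x)) * iexp (t * Y x) * (2 * \<i>)"
        unfolding left_diff_distrib[symmetric] complex_diff_cnj by simp
      show "complex_of_real (Im (D x)) * iexp (t * Y x) =
          (D x * iexp (t * Y x) - cnj (D x) * iexp (t * Y x)) / (2 * \<i>)"
        by (rule nonzero_eq_divide_eq[THEN iffD2, OF _ eq[symmetric]]) simp
    qed
    then show ?thesis using int1[of t] int2[of t] zero[of t] zero_cnj[of t] by simp
  qed
  then have Im_0: "expectation (\<lambda>x. Im (D x) * indicator A (Y x)) = 0"
    by (intro integral_indicator_eq_0_if_weighted_char_eq_0_real[where C = C])
      (use order_trans[OF abs_Im_le_cmod bound] \<open>C > 0\<close> in simp_all)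
  have int': "integrable M (\<lambda>x. D x * indicator A (Y x))"
    by (rule integrable_bounded_mult[where C = C]) (use bound in \<open>auto simp: indicator_def\<close>)
  show ?thesis
  proof (rule complex_eqI)
    show "Re (expectation (\<lambda>x. D x * indicator A (Y x))) = Re 0"
    proof -
      have "Re (D x * indicator A (Y x)) = Re (D x) * indicator A (Y x)" for x
        by (simp split: split_indicator)
      then show ?thesis using integral_Re[OF int'] Re_0 by simp
    qed
    show "Im (expectation (\<lambda>x. D x * indicator A (Y x))) = Im 0"
    proof -
      have "Im (D x * indicator A (Y x)) = Im (D x) * indicator A (Y x)" for x
        by (simp split: split_indicator)
      then show ?thesis using integral_Im[OF int'] Im_0 by simp
    qed
  qed
qed

text \<open>
  Multivariate uniqueness by treating one coordinate at a time. The exponentials of the coordinates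
  not yet treated are absorbed in the weight of the one-dimensional statement, and each indicator
  that has been obtained is absorbed in \<open>D\<close>.
\<close>

lemma integral_prod_indicator_eq_0_if_weighted_char_eq_0:
  fixes D :: "'a \<Rightarrow> complex" and Y :: "'j \<Rightarrow> 'a \<Rightarrow> real"
  assumes "finite J" and "C > 0" and "\<And>j. j \<in> J \<Longrightarrow> random_variable borel (Y j)"
    and "\<And>j. j \<in> J \<Longrightarrow> A j \<in> sets borel"
    and "random_variable borel D" and "\<And>x. norm (D x) \<le> C"
    and "\<And>s. expectation (\<lambda>x. D x * iexp (\<Sum>j\<in>J. s j * Y j x)) = 0"
  shows "expectation (\<lambda>x. D x * (\<Prod>j\<in>J. indicator (A j) (Y j x))) = 0"
  using assms
proof (induction J arbitrary: D rule: finite_induct)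
  case empty
  then show ?case by simp
next
  case (insert k J)
  have [measurable]: "random_variable borel (Y j)" if "j \<in> insert k J" for j
    using insert.prems that by auto
  have [measurable]: "A k \<in> sets borel" "random_variable borel (Y k)" "random_variable borel D"
    using insert.prems by auto
  have [measurable]: "(\<lambda>x. \<Sum>j\<in>J. s j * Y j x) \<in> borel_measurable M" for s
    by (rule borel_measurable_sum) simp
  have step: "expectation (\<lambda>x. (D x * indicator (A k) (Y k x)) * iexp (\<Sum>j\<in>J. s j * Y j x)) = 0" for s
  proof -
    have "expectation (\<lambda>x. (D x * iexp (\<Sum>j\<in>J. s j * Y j x)) * indicator (A k) (Y k x)) = 0"
    \<comment> \<open>The coefficient of \<open>Y k\<close> is free to vary while the other coefficients stay fixed.\<close>
    proof (rule integral_indicator_eq_0_if_weighted_char_eq_0)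
      fix t
      have "(\<Sum>j\<in>J. (s(k := t)) j * Y j x) = (\<Sum>j\<in>J. s j * Y j x)" for x
        using insert.hyps by (intro sum.cong) auto
      then have "(\<lambda>x. D x * iexp (\<Sum>j\<in>J. s j * Y j x) * iexp (t * Y k x)) =
          (\<lambda>x. D x * iexp (\<Sum>j\<in>insert k J. (s(k := t)) j * Y j x))"
        using insert.hyps by (auto simp: fun_eq_iff distrib_left exp_add simp del: fun_upd_apply)
          (simp add: fun_upd_apply)
      then show "expectation (\<lambda>x. D x * iexp (\<Sum>j\<in>J. s j * Y j x) * iexp (t * Y k x)) = 0"
        using insert.prems(6)[of "s(k := t)"] by simp
    qed (use insert.prems in \<open>auto simp: norm_mult\<close>)
    then show ?thesis by (simp add: mult.assoc mult.left_commute mult.commute)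
  qed
  have "expectation (\<lambda>x. (D x * indicator (A k) (Y k x)) * (\<Prod>j\<in>J. indicator (A j) (Y j x))) = 0"
    by (rule insert.IH) (use insert.prems step in \<open>auto simp: norm_mult indicator_def\<close>)
  then show ?case
    using insert.hyps by (simp add: mult.assoc)
qed

end

section \<open>Gaussian spaces: orthogonality implies independence\<close>

text \<open>
  Rectangles generate the product \<sigma>-algebra and are closed under intersections, so independence of
  random vectors has to be checked on them only.
\<close>

lemma sigma_sets_vimage_PiM:
  fixes Z :: "'i \<Rightarrow> 'a \<Rightarrow> real"
  assumes "finite I"
  shows "sigma_sets \<Omega> {(\<lambda>\<omega>. \<lambda>i\<in>I. Z i \<omega>) -` A \<inter> \<Omega> | A. A \<in> sets (Pi\<^sub>M I (\<lambda>_. borel))} =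
    sigma_sets \<Omega> {{\<omega>\<in>\<Omega>. \<forall>i\<in>I. Z i \<omega> \<in> A i} | A. \<forall>i\<in>I. A i \<in> sets borel}"
proof -
  let ?X = "\<lambda>\<omega>. \<lambda>i\<in>I. Z i \<omega>"
  let ?P = "prod_algebra I (\<lambda>_. borel :: real measure)"
  let ?R = "{{\<omega>\<in>\<Omega>. \<forall>i\<in>I. Z i \<omega> \<in> A i} | A. \<forall>i\<in>I. A i \<in> sets borel}"
  have "{?X -` A \<inter> \<Omega> | A. A \<in> sets (Pi\<^sub>M I (\<lambda>_. borel :: real measure))} =
      sigma_sets \<Omega> {?X -` A \<inter> \<Omega> | A. A \<in> ?P}"
    unfolding sets_PiM by (rule sigma_sets_vimage_commute) (auto simp: PiE_def)
  also have "{?X -` A \<inter> \<Omega> | A. A \<in> ?P} = ?R"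
  proof -
    have eq: "?X -` (Pi\<^sub>E I A) \<inter> \<Omega> = {\<omega>\<in>\<Omega>. \<forall>i\<in>I. Z i \<omega> \<in> A i}" for A
      by (auto simp: PiE_iff)
    have "{?X -` A \<inter> \<Omega> | A. A \<in> ?P} = (\<lambda>A. ?X -` A \<inter> \<Omega>) ` Pi\<^sub>E I ` (\<Pi> i\<in>I. sets borel)"
      unfolding prod_algebra_eq_finite[OF \<open>finite I\<close>] by auto
    also have "\<dots> = (\<lambda>A. {\<omega>\<in>\<Omega>. \<forall>i\<in>I. Z i \<omega> \<in> A i}) ` (\<Pi> i\<in>I. sets borel)"
      by (simp only: image_image eq)
    also have "\<dots> = ?R"
      by (simp add: image_def Pi_def Ball_def conj_commute)
    finally show ?thesis .
  qed
  finally have eq: "{?X -` A \<inter> \<Omega> | A. A \<in> sets (Pi\<^sub>M I (\<lambda>_. borel :: real measure))} = sigma_sets \<Omega> ?R" .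
  show ?thesis
    unfolding eq by (rule sigma_sets_sigma_sets_eq) blast
qed

lemma (in prob_space) indep_set_PiM_if_rectangles:
  fixes X :: "'i \<Rightarrow> 'a \<Rightarrow> real" and Y :: "'j \<Rightarrow> 'a \<Rightarrow> real"
  assumes "finite I" "finite J"
    and X: "\<And>i. i \<in> I \<Longrightarrow> random_variable borel (X i)"
    and Y: "\<And>j. j \<in> J \<Longrightarrow> random_variable borel (Y j)"
    and rect: "\<And>A B. (\<And>i. i \<in> I \<Longrightarrow> A i \<in> sets borel) \<Longrightarrow> (\<And>j. j \<in> J \<Longrightarrow> B j \<in> sets borel) \<Longrightarrow>
      prob ({\<omega>\<in>space M. \<forall>i\<in>I. X i \<omega> \<in> A i} \<inter> {\<omega>\<in>space M. \<forall>j\<in>J. Y j \<omega> \<in> B j}) =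
      prob {\<omega>\<in>space M. \<forall>i\<in>I. X i \<omega> \<in> A i} * prob {\<omega>\<in>space M. \<forall>j\<in>J. Y j \<omega> \<in> B j}"
  shows "indep_set {(\<lambda>\<omega>. \<lambda>i\<in>I. X i \<omega>) -` A \<inter> space M | A. A \<in> sets (Pi\<^sub>M I (\<lambda>_. borel))}
    {(\<lambda>\<omega>. \<lambda>j\<in>J. Y j \<omega>) -` B \<inter> space M | B. B \<in> sets (Pi\<^sub>M J (\<lambda>_. borel))}"
proof -
  have stable: "Int_stable {{\<omega>\<in>space M. \<forall>i\<in>K. Z i \<omega> \<in> A i} | A. \<forall>i\<in>K. A i \<in> sets borel}"
    for K :: "'k set" and Z :: "'k \<Rightarrow> 'a \<Rightarrow> real"
  proof (rule Int_stableI, safe)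
    fix A B :: "'k \<Rightarrow> real set"
    assume "\<forall>i\<in>K. A i \<in> sets borel" "\<forall>i\<in>K. B i \<in> sets borel"
    then show "\<exists>C. {\<omega> \<in> space M. \<forall>i\<in>K. Z i \<omega> \<in> A i} \<inter> {\<omega> \<in> space M. \<forall>i\<in>K. Z i \<omega> \<in> B i} =
        {\<omega> \<in> space M. \<forall>i\<in>K. Z i \<omega> \<in> C i} \<and> (\<forall>i\<in>K. C i \<in> sets borel)"
      by (intro exI[of _ "\<lambda>i. A i \<inter> B i"]) auto
  qed
  have rect_event: "{\<omega>\<in>space M. \<forall>i\<in>K. Z i \<omega> \<in> A i} \<in> events"
    if "finite K" "\<And>i. i \<in> K \<Longrightarrow> random_variable borel (Z i)" "\<And>i. i \<in> K \<Longrightarrow> A i \<in> sets borel"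
    for K :: "'k set" and Z :: "'k \<Rightarrow> 'a \<Rightarrow> real" and A
    using that by (intro sets.sets_Collect_finite_All) (auto intro: measurable_sets_Collect)
  let ?GX = "{{\<omega>\<in>space M. \<forall>i\<in>I. X i \<omega> \<in> A i} | A. \<forall>i\<in>I. A i \<in> sets borel}"
  let ?GY = "{{\<omega>\<in>space M. \<forall>j\<in>J. Y j \<omega> \<in> B j} | B. \<forall>j\<in>J. B j \<in> sets borel}"
  have "indep_set ?GX ?GY"
  proof (rule indep_setI)
    show "?GX \<subseteq> events" by (auto intro!: rect_event \<open>finite I\<close> X)
    show "?GY \<subseteq> events" by (auto intro!: rect_event \<open>finite J\<close> Y)
    show "prob (a \<inter> b) = prob a * prob b" if "a \<in> ?GX" "b \<in> ?GY" for a b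
      using that rect by blast
  qed
  from indep_set_sigma_sets[OF this stable stable]
  have "indep_set
     (sigma_sets (space M) {(\<lambda>\<omega>. \<lambda>i\<in>I. X i \<omega>) -` A \<inter> space M |A. A \<in> sets (Pi\<^sub>M I (\<lambda>_. borel))})
     (sigma_sets (space M) {(\<lambda>\<omega>. \<lambda>j\<in>J. Y j \<omega>) -` A \<inter> space M |A. A \<in> sets (Pi\<^sub>M J (\<lambda>_. borel))})"
    (is "indep_set (sigma_sets _ ?SX) (sigma_sets _ ?SY)")
    unfolding sigma_sets_vimage_PiM[OF \<open>finite I\<close>] sigma_sets_vimage_PiM[OF \<open>finite J\<close>] .
  then have sub: "sigma_sets (space M) ?SX \<subseteq> events" "sigma_sets (space M) ?SY \<subseteq> events"
    and eq: "\<And>a b. a \<in> sigma_sets (space M) ?SX \<Longrightarrow> b \<in> sigma_sets (space M) ?SY \<Longrightarrow> prob (a \<inter> b) = prob a * prob b"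
    unfolding indep_sets2_eq by blast+
  show ?thesis
  proof (rule indep_setI)
    show "?SX \<subseteq> events" by (rule order_trans[OF _ sub(1)]) (rule subsetI, erule sigma_sets.Basic)
    show "?SY \<subseteq> events" by (rule order_trans[OF _ sub(2)]) (rule subsetI, erule sigma_sets.Basic)
    show "prob (a \<inter> b) = prob a * prob b" if "a \<in> ?SX" "b \<in> ?SY" for a b
      by (rule eq[OF sigma_sets.Basic[OF that(1)] sigma_sets.Basic[OF that(2)]])
  qed
qed

lemma (in prob_space) gaussian_rv_add_const:
  assumes "gaussian_rv M X"
  shows "gaussian_rv M (\<lambda>\<omega>. X \<omega> + b)"
proof -
  have [measurable]: "X \<in> borel_measurable M" using assms by (simp add: gaussian_rv_def)
  from assms consider m s where "0 < s" "distributed M lborel X (normal_density m s)"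
    | m where "AE \<omega> in M. X \<omega> = m"
    by (auto simp: gaussian_rv_def)
  then show ?thesis
  proof cases
    case (1 m s)
    have "distributed M lborel (\<lambda>\<omega>. b + 1 * X \<omega>) (normal_density (b + 1 * m) (\<bar>1\<bar> * s))"
      by (rule normal_density_affine[OF 1(2,1)]) simp
    then have "distributed M lborel (\<lambda>\<omega>. X \<omega> + b) (normal_density (b + m) s)"
      by (simp add: add.commute)
    then show ?thesis using 1(1) by (auto simp: gaussian_rv_def)
  next
    case (2 m)
    then have "AE \<omega> in M. X \<omega> + b = m + b" by eventually_elim simp
    then show ?thesis by (auto simp: gaussian_rv_def)
  qed
qed

text \<open>
  Needed because the mean and covariance in the definition of the field are Bochner integrals, which
  take the value \<open>0\<close> for functions that are not integrable.
\<close>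

lemma (in prob_space) integrable_gaussian_rv:
  assumes "gaussian_rv M X"
  shows "integrable M X"
proof -
  have [measurable]: "X \<in> borel_measurable M" using assms by (simp add: gaussian_rv_def)
  from assms consider m s where "0 < s" "distributed M lborel X (normal_density m s)"
    | m where "AE \<omega> in M. X \<omega> = m"
    by (auto simp: gaussian_rv_def)
  then show ?thesis
  proof cases
    case (1 m s)
    then show ?thesis
      using distributed_integrable_var[of M X "normal_density m s"] integrable_normal_moment_nz_1[of s m] by simp
  next
    case (2 m)
    then have "integrable M X \<longleftrightarrow> integrable M (\<lambda>_. m)"
      by (intro integrable_cong_AE) auto
    then show ?thesis by simp
  qed
qed

text \<open>
  A vector space of centered Gaussian variables. All computations below stay in such a space, where
  the law of a vector is determined by its second moments.
\<close>

locale centered_gaussian_space = prob_space M for M :: "'a measure" +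
  fixes G :: "('a \<Rightarrow> real) set"
  assumes zero_mem: "(\<lambda>_. 0) \<in> G"
    and add_mem: "\<And>X Y. X \<in> G \<Longrightarrow> Y \<in> G \<Longrightarrow> (\<lambda>\<omega>. X \<omega> + Y \<omega>) \<in> G"
    and scale_mem: "\<And>X c. X \<in> G \<Longrightarrow> (\<lambda>\<omega>. c * X \<omega>) \<in> G"
    and gaussian: "\<And>X. X \<in> G \<Longrightarrow> gaussian_rv M X"
    and centered: "\<And>X. X \<in> G \<Longrightarrow> expectation X = 0"
begin

lemma sum_mem: "(\<And>i. i \<in> I \<Longrightarrow> X i \<in> G) \<Longrightarrow> (\<lambda>\<omega>. \<Sum>i\<in>I. c i * X i \<omega>) \<in> G"
proof (induction I rule: infinite_finite_induct)
  case (insert i I)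
  then show ?case
    using add_mem[OF scale_mem[of "X i" "c i"], of "\<lambda>\<omega>. \<Sum>i\<in>I. c i * X i \<omega>"] by simp
qed (simp_all add: zero_mem)

lemma measurable_mem: "X \<in> G \<Longrightarrow> random_variable borel X"
  using gaussian by (auto simp: gaussian_rv_def)

lemma degenerate_or_normal:
  assumes "X \<in> G"
  obtains (degenerate) "AE \<omega> in M. X \<omega> = 0"
  | (normal) s where "s > 0" "distributed M lborel X (normal_density 0 s)"
proof -
  consider m where "AE \<omega> in M. X \<omega> = m"
    | m s where "s > 0" "distributed M lborel X (normal_density m s)"
    using gaussian[OF assms] by (auto simp: gaussian_rv_def)
  then show thesis
  proof cases
    case (1 m)
    then have "expectation X = expectation (\<lambda>_. m)"
      using measurable_mem[OF assms] by (intro integral_cong_AE) auto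
    then have "m = 0" using centered[OF assms] by (simp add: prob_space)
    then show thesis using 1 degenerate by simp
  next
    case (2 m s)
    then have "m = 0" using normal_distributed_expectation[of s X m] centered[OF assms] by simp
    then show thesis using 2 normal by simp
  qed
qed

lemma integrable_power_abs:
  assumes "X \<in> G"
  shows "integrable M (\<lambda>\<omega>. \<bar>X \<omega>\<bar> ^ n)"
  using assms
proof (cases rule: degenerate_or_normal)
  case degenerate
  have "integrable M (\<lambda>\<omega>. \<bar>X \<omega>\<bar> ^ n) \<longleftrightarrow> integrable M (\<lambda>\<omega>. (0::real) ^ n)"
    using degenerate measurable_mem[OF assms] by (intro integrable_cong_AE) auto
  then show ?thesis by simp
next
  case (normal s)
  have "integrable lborel (\<lambda>x. normal_density 0 s x * \<bar>x\<bar> ^ n)"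
    using integrable_normal_moment_abs[of s 0 n] normal(1) by simp
  then show ?thesis
    using distributed_integrable[OF normal(2), of "\<lambda>x. \<bar>x\<bar> ^ n"] by simp
qed

lemma integrable_mult:
  assumes "X \<in> G" "Y \<in> G"
  shows "integrable M (\<lambda>\<omega>. X \<omega> * Y \<omega>)"
proof (rule Bochner_Integration.integrable_bound)
  show "integrable M (\<lambda>\<omega>. \<bar>X \<omega>\<bar> ^ 2 + \<bar>Y \<omega>\<bar> ^ 2)"
    using assms by (intro Bochner_Integration.integrable_add integrable_power_abs)
  show "(\<lambda>\<omega>. X \<omega> * Y \<omega>) \<in> borel_measurable M"
    using assms by (intro borel_measurable_times measurable_mem)
  have "\<bar>a * b\<bar> \<le> \<bar>a\<bar>\<^sup>2 + \<bar>b\<bar>\<^sup>2" for a b :: real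
  proof -
    have "2 * \<bar>a * b\<bar> \<le> \<bar>a\<bar>\<^sup>2 + \<bar>b\<bar>\<^sup>2"
      using sum_squares_bound[of "\<bar>a\<bar>" "\<bar>b\<bar>"] by (simp only: abs_mult mult.assoc)
    then show ?thesis using abs_ge_zero[of "a * b"] by linarith
  qed
  then show "AE \<omega> in M. norm (X \<omega> * Y \<omega>) \<le> norm (\<bar>X \<omega>\<bar> ^ 2 + \<bar>Y \<omega>\<bar> ^ 2)"
    by (simp del: power2_abs)
qed

lemma distributed_mem:
  assumes "X \<in> G" and "expectation (\<lambda>\<omega>. X \<omega> * X \<omega>) = s\<^sup>2" and "s > 0"
  shows "distributed M lborel X (normal_density 0 s)"
  using assms(1)
proof (cases rule: degenerate_or_normal)
  case degenerate
  then have "expectation (\<lambda>\<omega>. X \<omega> * X \<omega>) = expectation (\<lambda>_. 0)"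
    using measurable_mem[OF assms(1)] by (intro integral_cong_AE) auto
  then show ?thesis using assms by simp
next
  case (normal t)
  have "t\<^sup>2 = s\<^sup>2"
    using normal_distributed_variance[OF normal] centered[OF assms(1)] assms(2)
    by (simp add: power2_eq_square)
  then show ?thesis using normal assms(3) by (simp add: power2_eq_iff_nonneg)
qed

lemma expectation_iexp:
  assumes "X \<in> G"
  shows "expectation (\<lambda>\<omega>. iexp (X \<omega>)) = exp (- expectation (\<lambda>\<omega>. X \<omega> * X \<omega>) / 2)"
  using assms
proof (cases rule: degenerate_or_normal)
  case degenerate
  then have "expectation (\<lambda>\<omega>. X \<omega> * X \<omega>) = expectation (\<lambda>_. 0)"
    using measurable_mem[OF assms(1)] by (intro integral_cong_AE) auto
  moreover have "expectation (\<lambda>\<omega>. iexp (X \<omega>)) = expectation (\<lambda>_. iexp 0)"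
    using measurable_mem[OF assms(1)] degenerate by (intro integral_cong_AE) auto
  ultimately show ?thesis by (simp add: prob_space)
next
  case (normal s)
  have [measurable]: "random_variable borel X" by (rule measurable_mem[OF assms])
  have var: "expectation (\<lambda>\<omega>. X \<omega> * X \<omega>) = s\<^sup>2"
    using normal_distributed_variance[OF normal] centered[OF assms(1)]
    by (simp add: power2_eq_square)
  have "distributed M lborel (\<lambda>\<omega>. X \<omega> / s) std_normal_density"
    using normal_standard_normal_convert[OF normal(1), of X 0] normal(2) by simp
  then have "distr M lborel (\<lambda>\<omega>. X \<omega> / s) = std_normal_distribution"
    by (simp add: distributed_def)
  then have "char std_normal_distribution s = (CLINT x|distr M lborel (\<lambda>\<omega>. X \<omega> / s). iexp (s * x))"
    by (simp add: char_def)
  also have "\<dots> = expectation (\<lambda>\<omega>. iexp (s * (X \<omega> / s)))"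
    by (rule integral_distr) auto
  also have "\<dots> = expectation (\<lambda>\<omega>. iexp (X \<omega>))"
    using normal(1) by simp
  finally show ?thesis using var by (simp add: char_std_normal_distribution)
qed

lemma expectation_sum_mult:
  assumes "\<And>i. i \<in> I \<Longrightarrow> X i \<in> G" "Y \<in> G"
  shows "expectation (\<lambda>\<omega>. (\<Sum>i\<in>I. c i * X i \<omega>) * Y \<omega>) = (\<Sum>i\<in>I. c i * expectation (\<lambda>\<omega>. X i \<omega> * Y \<omega>))"
proof -
  have "expectation (\<lambda>\<omega>. (\<Sum>i\<in>I. c i * X i \<omega>) * Y \<omega>) = expectation (\<lambda>\<omega>. \<Sum>i\<in>I. c i * (X i \<omega> * Y \<omega>))"
    by (simp add: sum_distrib_right mult.assoc)
  also have "\<dots> = (\<Sum>i\<in>I. c i * expectation (\<lambda>\<omega>. X i \<omega> * Y \<omega>))"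
    using assms by (subst Bochner_Integration.integral_sum) (auto intro: integrable_mult)
  finally show ?thesis .
qed

text \<open>
  Orthogonality makes the variance additive, so the characteristic function of the sum factorises.
\<close>

lemma expectation_iexp_add:
  assumes "U \<in> G" "V \<in> G" and orth: "expectation (\<lambda>\<omega>. U \<omega> * V \<omega>) = 0"
  shows "expectation (\<lambda>\<omega>. iexp (U \<omega> + V \<omega>)) = expectation (\<lambda>\<omega>. iexp (U \<omega>)) * expectation (\<lambda>\<omega>. iexp (V \<omega>))"
proof -
  have "expectation (\<lambda>\<omega>. (U \<omega> + V \<omega>) * (U \<omega> + V \<omega>)) =
      expectation (\<lambda>\<omega>. U \<omega> * U \<omega> + V \<omega> * V \<omega> + 2 * (U \<omega> * V \<omega>))"
    by (simp add: algebra_simps)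
  also have "\<dots> = expectation (\<lambda>\<omega>. U \<omega> * U \<omega>) + expectation (\<lambda>\<omega>. V \<omega> * V \<omega>)"
    using assms integrable_mult by simp
  finally have "expectation (\<lambda>\<omega>. iexp (U \<omega> + V \<omega>)) =
      exp (- (expectation (\<lambda>\<omega>. U \<omega> * U \<omega>) + expectation (\<lambda>\<omega>. V \<omega> * V \<omega>)) / 2)"
    using expectation_iexp[OF add_mem[OF assms(1,2)]] by simp
  also have "\<dots> = expectation (\<lambda>\<omega>. iexp (U \<omega>)) * expectation (\<lambda>\<omega>. iexp (V \<omega>))"
    unfolding expectation_iexp[OF assms(1)] expectation_iexp[OF assms(2)]
    by (simp add: add_divide_distrib diff_divide_distrib flip: exp_of_real exp_add)
  finally show ?thesis .
qed

text \<open>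
  The joint characteristic function of the two blocks factorises. Multivariate uniqueness is applied
  twice: with weight \<open>e\<^bsup>iU\<^esup> - E e\<^bsup>iU\<^esup>\<close> it replaces the exponentials of the second block by indicators, and
  with weight \<open>1\<^sub>B - P(B)\<close> it does the same for the first block. Correlation inside a block does not
  matter.
\<close>

lemma prob_rectangle_orthogonal:
  fixes X :: "'i \<Rightarrow> 'a \<Rightarrow> real" and Y :: "'j \<Rightarrow> 'a \<Rightarrow> real"
  assumes "finite I" "finite J"
    and X: "\<And>i. i \<in> I \<Longrightarrow> X i \<in> G" and Y: "\<And>j. j \<in> J \<Longrightarrow> Y j \<in> G"
    and orth: "\<And>i j. i \<in> I \<Longrightarrow> j \<in> J \<Longrightarrow> expectation (\<lambda>\<omega>. X i \<omega> * Y j \<omega>) = 0"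
    and A: "\<And>i. i \<in> I \<Longrightarrow> A i \<in> sets borel" and B: "\<And>j. j \<in> J \<Longrightarrow> B j \<in> sets borel"
  shows "prob ({\<omega>\<in>space M. \<forall>i\<in>I. X i \<omega> \<in> A i} \<inter> {\<omega>\<in>space M. \<forall>j\<in>J. Y j \<omega> \<in> B j}) =
      prob {\<omega>\<in>space M. \<forall>i\<in>I. X i \<omega> \<in> A i} * prob {\<omega>\<in>space M. \<forall>j\<in>J. Y j \<omega> \<in> B j}"
proof -
  define U where "U t \<omega> = (\<Sum>i\<in>I. t i * X i \<omega>)" for t :: "'i \<Rightarrow> real" and \<omega>
  define V where "V s \<omega> = (\<Sum>j\<in>J. s j * Y j \<omega>)" for s :: "'j \<Rightarrow> real" and \<omega>
  define a :: "'a \<Rightarrow> complex" where "a \<omega> = (\<Prod>i\<in>I. indicator (A i) (X i \<omega>))" for \<omega>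
  define b :: "'a \<Rightarrow> complex" where "b \<omega> = (\<Prod>j\<in>J. indicator (B j) (Y j \<omega>))" for \<omega>
  define EA where "EA = {\<omega>\<in>space M. \<forall>i\<in>I. X i \<omega> \<in> A i}"
  define EB where "EB = {\<omega>\<in>space M. \<forall>j\<in>J. Y j \<omega> \<in> B j}"
  have U_mem: "U t \<in> G" and V_mem: "V s \<in> G" for t s
    unfolding U_def V_def using X Y by (auto intro: sum_mem)
  have XY_meas: "\<And>i. i \<in> I \<Longrightarrow> random_variable borel (X i)" "\<And>j. j \<in> J \<Longrightarrow> random_variable borel (Y j)"
    using X Y measurable_mem by auto
  have [measurable]: "random_variable borel (U t)" "random_variable borel (V s)" for t s
    using U_mem V_mem measurable_mem by auto
  have [measurable]: "EA \<in> events" "EB \<in> events"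
    unfolding EA_def EB_def using \<open>finite I\<close> \<open>finite J\<close> XY_meas A B
    by (auto intro!: sets.sets_Collect_finite_All measurable_sets_Collect)
  have a_eq: "a \<omega> = indicator EA \<omega>" and b_eq: "b \<omega> = indicator EB \<omega>" if "\<omega> \<in> space M" for \<omega>
    using that \<open>finite I\<close> \<open>finite J\<close>
    by (auto simp: a_def b_def EA_def EB_def indicator_def)
  have UV: "expectation (\<lambda>\<omega>. U t \<omega> * V s \<omega>) = 0" for t s
  proof -
    have *: "expectation (\<lambda>\<omega>. X i \<omega> * V s \<omega>) = 0" if "i \<in> I" for i
      using expectation_sum_mult[of J Y "X i" s] that orth X Y
      by (simp add: V_def mult.commute)
    show ?thesis
      using expectation_sum_mult[of I X "V s" t] * X V_mem by (simp add: U_def)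
  qed
  have iexp_factor: "expectation (\<lambda>\<omega>. iexp (U t \<omega>) * iexp (V s \<omega>)) =
      expectation (\<lambda>\<omega>. iexp (U t \<omega>)) * expectation (\<lambda>\<omega>. iexp (V s \<omega>))" for t s
    using expectation_iexp_add[OF U_mem V_mem UV] by (simp add: distrib_left exp_add)
  have int: "integrable M f" if [measurable]: "random_variable borel f" and "\<And>\<omega>. norm (f \<omega>) \<le> 1" for f :: "'a \<Rightarrow> complex"
    by (rule integrable_const_bound[of _ 1]) (use that in auto)
  have norm_char: "norm (expectation (\<lambda>\<omega>. iexp (U t \<omega>))) \<le> 1" for t
    using integral_norm_bound[of M "\<lambda>\<omega>. iexp (U t \<omega>)"] by (simp add: prob_space)
  have b_norm: "norm (b \<omega>) \<le> 1" for \<omega>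
    unfolding b_def by (auto simp: indicator_def intro!: prod_le_1 simp flip: prod_norm)
  have [measurable]: "random_variable borel b"
    using b_eq by (subst measurable_cong) (auto intro: borel_measurable_indicator)
  have int_b: "integrable M b"
    using b_norm by (intro int) auto
  have int_Ub: "integrable M (\<lambda>\<omega>. iexp (U t \<omega>) * b \<omega>)" for t
    using b_norm by (intro int) (auto simp: norm_mult)
  have U_b: "expectation (\<lambda>\<omega>. iexp (U t \<omega>) * b \<omega>) = expectation (\<lambda>\<omega>. iexp (U t \<omega>)) * prob EB" for t
  proof -
    define c where "c = expectation (\<lambda>\<omega>. iexp (U t \<omega>))"
    have "expectation (\<lambda>\<omega>. (iexp (U t \<omega>) - c) * b \<omega>) = 0"
      unfolding b_def
    proof (rule integral_prod_indicator_eq_0_if_weighted_char_eq_0[where C = 2])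
      show "norm (iexp (U t \<omega>) - c) \<le> 2" for \<omega>
        using norm_triangle_ineq4[of "iexp (U t \<omega>)" c] norm_char[of t] by (simp add: c_def)
      show "expectation (\<lambda>\<omega>. (iexp (U t \<omega>) - c) * iexp (\<Sum>j\<in>J. s j * Y j \<omega>)) = 0" for s
      proof -
        have "expectation (\<lambda>\<omega>. iexp (U t \<omega>) * iexp (V s \<omega>) - c * iexp (V s \<omega>)) = 0"
        proof (subst Bochner_Integration.integral_diff)
          show "integrable M (\<lambda>\<omega>. iexp (U t \<omega>) * iexp (V s \<omega>))"
            by (rule int) (simp_all add: norm_mult)
          show "integrable M (\<lambda>\<omega>. c * iexp (V s \<omega>))"
            by (intro integrable_mult_right int) simp_all
          show "expectation (\<lambda>\<omega>. iexp (U t \<omega>) * iexp (V s \<omega>)) - expectation (\<lambda>\<omega>. c * iexp (V s \<omega>)) = 0"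
            unfolding iexp_factor c_def integral_mult_right_zero by (rule diff_self)
        qed
        then show ?thesis unfolding V_def left_diff_distrib .
      qed
    qed (use \<open>finite J\<close> XY_meas B in auto)
    then have "expectation (\<lambda>\<omega>. iexp (U t \<omega>) * b \<omega> - c * b \<omega>) = 0"
      by (simp only: left_diff_distrib)
    then have "expectation (\<lambda>\<omega>. iexp (U t \<omega>) * b \<omega>) = c * expectation b"
      using int_Ub[of t] int_b by (subst (asm) Bochner_Integration.integral_diff) auto
    also have "expectation b = expectation (\<lambda>\<omega>. complex_of_real (indicator EB \<omega>))"
      using b_eq by (intro Bochner_Integration.integral_cong) (auto simp: indicator_def)
    also have "\<dots> = prob EB"
      unfolding integral_complex_of_real by simp
    finally show ?thesis by (simp only: c_def)
  qed
  have "expectation (\<lambda>\<omega>. (b \<omega> - prob EB) * a \<omega>) = 0"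
    unfolding a_def
  proof (rule integral_prod_indicator_eq_0_if_weighted_char_eq_0[where C = 2])
    show "norm (b \<omega> - prob EB) \<le> 2" for \<omega>
      using norm_triangle_ineq4[of "b \<omega>" "prob EB"] b_norm[of \<omega>] by simp (smt (verit) prob_le_1)
    show "expectation (\<lambda>\<omega>. (b \<omega> - prob EB) * iexp (\<Sum>i\<in>I. t i * X i \<omega>)) = 0" for t
    proof -
      have "expectation (\<lambda>\<omega>. iexp (U t \<omega>) * b \<omega> - prob EB * iexp (U t \<omega>)) = 0"
        using U_b[of t] int_Ub[of t] int[of "\<lambda>\<omega>. iexp (U t \<omega>)"]
        by (subst Bochner_Integration.integral_diff) auto
      then show ?thesis unfolding U_def left_diff_distrib by (simp only: mult.commute)
    qed
  qed (use \<open>finite I\<close> XY_meas A in auto)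
  moreover have "expectation (\<lambda>\<omega>. (b \<omega> - prob EB) * a \<omega>) =
      expectation (\<lambda>\<omega>. complex_of_real (indicator (EA \<inter> EB) \<omega> - prob EB * indicator EA \<omega>))"
    using a_eq b_eq by (intro Bochner_Integration.integral_cong) (auto simp: indicator_def)
  ultimately have "expectation (\<lambda>\<omega>. indicator (EA \<inter> EB) \<omega> - prob EB * indicator EA \<omega>) = 0"
    unfolding integral_complex_of_real by simp
  moreover have "expectation (\<lambda>\<omega>. indicator (EA \<inter> EB) \<omega> - prob EB * indicator EA \<omega>) = prob (EA \<inter> EB) - prob EB * prob EA"
    by (subst Bochner_Integration.integral_diff) (auto simp: emeasure_eq_measure)
  ultimately show ?thesis by (simp add: EA_def EB_def mult.commute)
qed

lemma indep_set_if_orthogonal: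
  fixes X :: "'i \<Rightarrow> 'a \<Rightarrow> real" and Y :: "'j \<Rightarrow> 'a \<Rightarrow> real"
  assumes "finite I" "finite J"
    and X: "\<And>i. i \<in> I \<Longrightarrow> X i \<in> G" and Y: "\<And>j. j \<in> J \<Longrightarrow> Y j \<in> G"
    and orth: "\<And>i j. i \<in> I \<Longrightarrow> j \<in> J \<Longrightarrow> expectation (\<lambda>\<omega>. X i \<omega> * Y j \<omega>) = 0"
  shows "indep_set {(\<lambda>\<omega>. \<lambda>i\<in>I. X i \<omega>) -` A \<inter> space M | A. A \<in> sets (Pi\<^sub>M I (\<lambda>_. borel))}
    {(\<lambda>\<omega>. \<lambda>j\<in>J. Y j \<omega>) -` B \<inter> space M | B. B \<in> sets (Pi\<^sub>M J (\<lambda>_. borel))}"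
  using assms by (intro indep_set_PiM_if_rectangles prob_rectangle_orthogonal measurable_mem)

text \<open>
  Splitting off one variable at a time reduces mutual independence to the independence of two blocks.
\<close>

lemma indep_vars_if_orthogonal:
  fixes X :: "'i \<Rightarrow> 'a \<Rightarrow> real"
  assumes X: "\<And>i. i \<in> I \<Longrightarrow> X i \<in> G"
    and orth: "\<And>i j. i \<in> I \<Longrightarrow> j \<in> I \<Longrightarrow> i \<noteq> j \<Longrightarrow> expectation (\<lambda>\<omega>. X i \<omega> * X j \<omega>) = 0"
  shows "indep_vars (\<lambda>_. borel) X I"
proof -
  have prod: "prob {\<omega>\<in>space M. \<forall>j\<in>J. X j \<omega> \<in> B j} = (\<Prod>j\<in>J. prob (X j -` B j \<inter> space M))"
    if "finite J" "J \<subseteq> I" "\<And>j. j \<in> J \<Longrightarrow> B j \<in> sets borel" for J B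
    using that
  proof (induction J rule: finite_induct)
    case empty
    then show ?case by (simp add: prob_space)
  next
    case (insert k J)
    have "prob {\<omega>\<in>space M. \<forall>j\<in>insert k J. X j \<omega> \<in> B j} =
        prob ({\<omega>\<in>space M. \<forall>j\<in>{k}. X j \<omega> \<in> B j} \<inter> {\<omega>\<in>space M. \<forall>j\<in>J. X j \<omega> \<in> B j})"
      by (rule arg_cong[where f = prob]) auto
    also have "\<dots> = prob {\<omega>\<in>space M. \<forall>j\<in>{k}. X j \<omega> \<in> B j} * prob {\<omega>\<in>space M. \<forall>j\<in>J. X j \<omega> \<in> B j}"
    proof (rule prob_rectangle_orthogonal)
      show "expectation (\<lambda>\<omega>. X i \<omega> * X j \<omega>) = 0" if "i \<in> {k}" "j \<in> J" for i j
        using orth[of i j] that insert by auto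
    qed (use insert X in auto)
    also have "{\<omega>\<in>space M. \<forall>j\<in>{k}. X j \<omega> \<in> B j} = X k -` B k \<inter> space M"
      by auto
    finally show ?case using insert by simp
  qed
  show ?thesis
    unfolding indep_vars_def2
  proof (intro conjI ballI indep_setsI)
    fix A J assume J: "J \<noteq> {}" "J \<subseteq> I" "finite J"
      and A: "\<forall>j\<in>J. A j \<in> {X j -` A \<inter> space M |A. A \<in> sets borel}"
    then obtain B where B: "\<And>j. j \<in> J \<Longrightarrow> A j = X j -` B j \<inter> space M" "\<And>j. j \<in> J \<Longrightarrow> B j \<in> sets borel"
      by simp metis
    have "(\<Inter>j\<in>J. A j) = {\<omega>\<in>space M. \<forall>j\<in>J. X j \<omega> \<in> B j}"
      using B(1) J(1) by auto
    then show "prob (\<Inter>j\<in>J. A j) = (\<Prod>j\<in>J. prob (A j))"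
      using prod[OF J(3,2) B(2)] B(1) by simp
  qed (use measurable_mem[OF X] in auto)
qed

end

text \<open>
  Integrability of a product does not pass to further products, but the existence of all moments
  does, by \<open>2 |ab|\<^sup>n \<le> |a|\<^sup>2\<^sup>n + |b|\<^sup>2\<^sup>n\<close>; therefore the induction runs over all powers at once.
\<close>

lemma (in centered_gaussian_space) integrable_power_prod_affine:
  assumes "finite S" and "\<And>x. x \<in> S \<Longrightarrow> X x \<in> G"
  shows "integrable M (\<lambda>\<omega>. \<bar>\<Prod>x\<in>S. c x + X x \<omega>\<bar> ^ n)"
  using assms
proof (induction S arbitrary: n rule: finite_induct)
  case empty
  then show ?case by simp
next
  case (insert k S)
  have [measurable]: "random_variable borel (X x)" if "x \<in> insert k S" for x
    using insert.prems that measurable_mem by auto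
  have [measurable]: "random_variable borel (\<lambda>\<omega>. \<Prod>x\<in>S. c x + X x \<omega>)"
    by (intro borel_measurable_prod) simp
  have single: "integrable M (\<lambda>\<omega>. \<bar>c k + X k \<omega>\<bar> ^ m)" for m
  proof (rule Bochner_Integration.integrable_bound)
    show "integrable M (\<lambda>\<omega>. \<Sum>i\<le>m. of_nat (m choose i) * \<bar>c k\<bar> ^ i * \<bar>X k \<omega>\<bar> ^ (m - i))"
      using insert.prems by (intro Bochner_Integration.integrable_sum integrable_mult_right integrable_power_abs) auto
    show "AE \<omega> in M. norm (\<bar>c k + X k \<omega>\<bar> ^ m) \<le>
        norm (\<Sum>i\<le>m. of_nat (m choose i) * \<bar>c k\<bar> ^ i * \<bar>X k \<omega>\<bar> ^ (m - i))"
      unfolding binomial_ring[symmetric] by (auto intro!: AE_I2 power_mono)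
  qed simp
  have split: "\<bar>a * b\<bar> ^ n \<le> \<bar>a\<bar> ^ (2 * n) + \<bar>b\<bar> ^ (2 * n)" for a b :: real
  proof -
    have "2 * (\<bar>a\<bar> ^ n * \<bar>b\<bar> ^ n) \<le> (\<bar>a\<bar> ^ n)\<^sup>2 + (\<bar>b\<bar> ^ n)\<^sup>2"
      using sum_squares_bound[of "\<bar>a\<bar> ^ n" "\<bar>b\<bar> ^ n"] by (simp only: mult.assoc)
    moreover have "0 \<le> \<bar>a\<bar> ^ n * \<bar>b\<bar> ^ n" by simp
    ultimately have "\<bar>a\<bar> ^ n * \<bar>b\<bar> ^ n \<le> (\<bar>a\<bar> ^ n)\<^sup>2 + (\<bar>b\<bar> ^ n)\<^sup>2" by linarith
    then show ?thesis by (simp only: abs_mult power_mult_distrib power_mult[symmetric] mult.commute[of n 2])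
  qed
  have "integrable M (\<lambda>\<omega>. \<bar>(c k + X k \<omega>) * (\<Prod>x\<in>S. c x + X x \<omega>)\<bar> ^ n)"
  proof (rule Bochner_Integration.integrable_bound)
    show "integrable M (\<lambda>\<omega>. \<bar>c k + X k \<omega>\<bar> ^ (2 * n) + \<bar>\<Prod>x\<in>S. c x + X x \<omega>\<bar> ^ (2 * n))"
      using single insert by (intro Bochner_Integration.integrable_add) auto
    show "AE \<omega> in M. norm (\<bar>(c k + X k \<omega>) * (\<Prod>x\<in>S. c x + X x \<omega>)\<bar> ^ n) \<le>
        norm (\<bar>c k + X k \<omega>\<bar> ^ (2 * n) + \<bar>\<Prod>x\<in>S. c x + X x \<omega>\<bar> ^ (2 * n))"
    proof (rule AE_I2)
      fix \<omega>
      show "norm (\<bar>(c k + X k \<omega>) * (\<Prod>x\<in>S. c x + X x \<omega>)\<bar> ^ n) \<le>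
        norm (\<bar>c k + X k \<omega>\<bar> ^ (2 * n) + \<bar>\<Prod>x\<in>S. c x + X x \<omega>\<bar> ^ (2 * n))"
        using order_trans[OF split abs_ge_self, of "c k + X k \<omega>" "\<Prod>x\<in>S. c x + X x \<omega>"]
        unfolding real_norm_def power_abs[symmetric] abs_abs .
    qed
  qed simp
  then show ?case using insert.hyps by simp
qed

lemma (in centered_gaussian_space) integrable_prod_affine:
  assumes "finite S" and X: "\<And>x. x \<in> S \<Longrightarrow> X x \<in> G"
  shows "integrable M (\<lambda>\<omega>. \<Prod>x\<in>S. c x + X x \<omega>)"
proof -
  have "random_variable borel (\<lambda>\<omega>. \<Prod>x\<in>S. c x + X x \<omega>)"
    using X measurable_mem by (intro borel_measurable_prod borel_measurable_add) auto
  then show ?thesis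
    using integrable_power_prod_affine[OF assms, where c = c and n = 1] integrable_abs_iff[of "\<lambda>\<omega>. \<Prod>x\<in>S. c x + X x \<omega>" M] by simp
qed

section \<open>Conditioning a function of two independent variables\<close>

context prob_space
begin

lemma sets_vimage_algebra_random_variable:
  "random_variable E X \<Longrightarrow> sets (vimage_algebra (space M) X E) = {X -` A \<inter> space M | A. A \<in> sets E}"
  by (intro sets_vimage_algebra2) (auto dest: measurable_space)

lemma subalgebra_vimage_algebra: "random_variable E X \<Longrightarrow> subalgebra M (vimage_algebra (space M) X E)"
  unfolding subalgebra_def
  by (auto simp: sets_vimage_algebra_random_variable intro: measurable_sets)

lemma sigma_finite_subalgebra_vimage_algebra:
  "random_variable E X \<Longrightarrow> sigma_finite_subalgebra M (vimage_algebra (space M) X E)"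
  using finite_measure_subalgebra_is_sigma_finite[of M "vimage_algebra (space M) X E"] subalgebra_vimage_algebra[of X E]
  by (simp add: finite_measure_subalgebra_def finite_measure_subalgebra_axioms_def finite_measure_axioms)

lemma measurable_vimage_algebra_self: "random_variable E X \<Longrightarrow> X \<in> vimage_algebra (space M) X E \<rightarrow>\<^sub>M E"
  by (intro measurable_vimage_algebra1) (auto dest: measurable_space)

text \<open>
  The value types of \<open>X\<close> and \<open>Y\<close> are unrelated, since a vector indexed by naturals has to be compared
  with a family indexed by lattice sites.
\<close>

definition indep_generated :: "'b measure \<Rightarrow> ('a \<Rightarrow> 'b) \<Rightarrow> 'c measure \<Rightarrow> ('a \<Rightarrow> 'c) \<Rightarrow> bool" where
  "indep_generated E X F Y \<longleftrightarrow> random_variable E X \<and> random_variable F Y \<and>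
     indep_set {X -` A \<inter> space M | A. A \<in> sets E} {Y -` B \<inter> space M | B. B \<in> sets F}"

lemma indep_generatedD:
  assumes "indep_generated E X F Y"
  shows "random_variable E X" "random_variable F Y"
    "A \<in> sets E \<Longrightarrow> B \<in> sets F \<Longrightarrow>
      prob ((X -` A \<inter> space M) \<inter> (Y -` B \<inter> space M)) = prob (X -` A \<inter> space M) * prob (Y -` B \<inter> space M)"
  using assms unfolding indep_generated_def indep_sets2_eq by blast+

lemma indep_generated_compose:
  assumes ind: "indep_generated E X F Y" and p: "p \<in> E \<rightarrow>\<^sub>M E'"
  shows "indep_generated E' (\<lambda>\<omega>. p (X \<omega>)) F Y"
proof -
  note [measurable] = indep_generatedD(1,2)[OF ind] p
  have "prob ((\<lambda>\<omega>. p (X \<omega>)) -` A \<inter> space M \<inter> (Y -` B \<inter> space M)) =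
      prob ((\<lambda>\<omega>. p (X \<omega>)) -` A \<inter> space M) * prob (Y -` B \<inter> space M)"
    if "A \<in> sets E'" "B \<in> sets F" for A B
  proof -
    have "(\<lambda>\<omega>. p (X \<omega>)) -` A \<inter> space M = X -` (p -` A \<inter> space E) \<inter> space M"
      using measurable_space[OF indep_generatedD(1)[OF ind]] by auto
    then show ?thesis
      using indep_generatedD(3)[OF ind measurable_sets[OF p that(1)] that(2)] by simp
  qed
  then show ?thesis
    unfolding indep_generated_def indep_sets2_eq by (auto intro!: measurable_sets)
qed

lemma distr_pair_indep_generated:
  assumes ind: "indep_generated E X F Y"
  shows "distr M (E \<Otimes>\<^sub>M F) (\<lambda>\<omega>. (X \<omega>, Y \<omega>)) = distr M E X \<Otimes>\<^sub>M distr M F Y"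
proof -
  note [measurable] = indep_generatedD(1,2)[OF ind]
  interpret DX: prob_space "distr M E X" by (rule prob_space_distr) simp
  interpret DY: prob_space "distr M F Y" by (rule prob_space_distr) simp
  show ?thesis
  proof (rule pair_measure_eqI[symmetric])
    fix A B assume "A \<in> sets (distr M E X)" "B \<in> sets (distr M F Y)"
    then have AB [measurable]: "A \<in> sets E" "B \<in> sets F" by auto
    have "(\<lambda>\<omega>. (X \<omega>, Y \<omega>)) -` (A \<times> B) \<inter> space M = (X -` A \<inter> space M) \<inter> (Y -` B \<inter> space M)"
      by auto
    then show "emeasure (distr M E X) A * emeasure (distr M F Y) B =
        emeasure (distr M (E \<Otimes>\<^sub>M F) (\<lambda>\<omega>. (X \<omega>, Y \<omega>))) (A \<times> B)"
      using indep_generatedD(3)[OF ind AB]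
      by (simp add: emeasure_distr emeasure_eq_measure ennreal_mult)
  qed (auto intro: DX.sigma_finite_measure_axioms DY.sigma_finite_measure_axioms)
qed

text \<open>
  The joint law of independent \<open>X\<close> and \<open>Y\<close> is a product measure. An event generated by \<open>X\<close> depends on
  the first coordinate only, so the defining identity of the conditional expectation is Fubini's
  theorem.
\<close>

lemma real_cond_exp_freeze:
  fixes f :: "'b \<times> 'c \<Rightarrow> real"
  assumes ind: "indep_generated E X F Y" and f [measurable]: "f \<in> borel_measurable (E \<Otimes>\<^sub>M F)"
    and int: "integrable M (\<lambda>\<omega>. f (X \<omega>, Y \<omega>))"
  shows "AE \<omega> in M. real_cond_exp M (vimage_algebra (space M) X E) (\<lambda>\<omega>. f (X \<omega>, Y \<omega>)) \<omega> =
    (\<integral>\<omega>'. f (X \<omega>, Y \<omega>') \<partial>M)"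
proof -
  note [measurable] = indep_generatedD(1,2)[OF ind]
  interpret DX: prob_space "distr M E X" by (rule prob_space_distr) simp
  interpret DY: prob_space "distr M F Y" by (rule prob_space_distr) simp
  interpret P: pair_sigma_finite "distr M E X" "distr M F Y" ..
  interpret sigma_finite_subalgebra M "vimage_algebra (space M) X E"
    by (rule sigma_finite_subalgebra_vimage_algebra) simp
  define g where "g x = (\<integral>y. f (x, y) \<partial>distr M F Y)" for x
  have g_eq: "g x = (\<integral>\<omega>'. f (x, Y \<omega>') \<partial>M)" if "x \<in> space E" for x
    unfolding g_def using that by (intro integral_distr) auto
  have g [measurable]: "g \<in> borel_measurable E"
    unfolding g_def by (intro DY.borel_measurable_lebesgue_integral) simp
  note pair = distr_pair_indep_generated[OF ind, symmetric]
  have fubini: "integrable M (\<lambda>\<omega>. \<integral>y. k (X \<omega>, y) \<partial>distr M F Y)"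
      "expectation (\<lambda>\<omega>. \<integral>y. k (X \<omega>, y) \<partial>distr M F Y) = expectation (\<lambda>\<omega>. k (X \<omega>, Y \<omega>))"
    if k [measurable]: "k \<in> borel_measurable (E \<Otimes>\<^sub>M F)" and "integrable M (\<lambda>\<omega>. k (X \<omega>, Y \<omega>))"
    for k :: "'b \<times> 'c \<Rightarrow> real"
  proof -
    have int_k: "integrable (distr M E X \<Otimes>\<^sub>M distr M F Y) k"
      unfolding pair using that by (simp add: integrable_distr_eq)
    have meas: "(\<lambda>x. \<integral>y. k (x, y) \<partial>distr M F Y) \<in> borel_measurable E"
      by (intro DY.borel_measurable_lebesgue_integral) simp
    show "integrable M (\<lambda>\<omega>. \<integral>y. k (X \<omega>, y) \<partial>distr M F Y)"
      using P.integrable_fst'[OF int_k] meas by (simp add: integrable_distr_eq)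
    have "expectation (\<lambda>\<omega>. \<integral>y. k (X \<omega>, y) \<partial>distr M F Y) = (\<integral>x. (\<integral>y. k (x, y) \<partial>distr M F Y) \<partial>distr M E X)"
      using meas by (simp add: integral_distr)
    also have "\<dots> = integral\<^sup>L (distr M E X \<Otimes>\<^sub>M distr M F Y) k"
      by (rule P.integral_fst'[OF int_k])
    also have "\<dots> = expectation (\<lambda>\<omega>. k (X \<omega>, Y \<omega>))"
      unfolding pair by (rule integral_distr) auto
    finally show "expectation (\<lambda>\<omega>. \<integral>y. k (X \<omega>, y) \<partial>distr M F Y) = expectation (\<lambda>\<omega>. k (X \<omega>, Y \<omega>))" .
  qed
  have "AE \<omega> in M. real_cond_exp M (vimage_algebra (space M) X E) (\<lambda>\<omega>. f (X \<omega>, Y \<omega>)) \<omega> = g (X \<omega>)"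
  proof (rule real_cond_exp_charact)
    show "integrable M (\<lambda>\<omega>. g (X \<omega>))"
      unfolding g_def by (rule fubini(1)[OF f int])
    show "(\<lambda>\<omega>. g (X \<omega>)) \<in> borel_measurable (vimage_algebra (space M) X E)"
      by (rule measurable_compose[OF measurable_vimage_algebra_self]) auto
    fix b assume "b \<in> sets (vimage_algebra (space M) X E)"
    then obtain A where A [measurable]: "A \<in> sets E" and b: "b = X -` A \<inter> space M"
      using sets_vimage_algebra_random_variable[OF indep_generatedD(1)[OF ind]] by auto
    define k where "k p = indicator A (fst p) * f p" for p
    have k [measurable]: "k \<in> borel_measurable (E \<Otimes>\<^sub>M F)"
      unfolding k_def by measurable
    have int_k: "integrable M (\<lambda>\<omega>. k (X \<omega>, Y \<omega>))"
    proof (rule Bochner_Integration.integrable_bound[OF int])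
      show "AE \<omega> in M. norm (k (X \<omega>, Y \<omega>)) \<le> norm (f (X \<omega>, Y \<omega>))"
        by (simp add: k_def indicator_def)
    qed simp
    have "(\<integral>\<omega>\<in>b. f (X \<omega>, Y \<omega>) \<partial>M) = expectation (\<lambda>\<omega>. k (X \<omega>, Y \<omega>))"
      unfolding set_lebesgue_integral_def
      by (intro Bochner_Integration.integral_cong refl) (auto simp: k_def b indicator_def)
    also have "\<dots> = expectation (\<lambda>\<omega>. \<integral>y. k (X \<omega>, y) \<partial>distr M F Y)"
      by (rule fubini(2)[OF k int_k, symmetric])
    also have "\<dots> = (\<integral>\<omega>\<in>b. g (X \<omega>) \<partial>M)"
      unfolding set_lebesgue_integral_def g_def
      by (intro Bochner_Integration.integral_cong refl) (auto simp: k_def b indicator_def)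
    finally show "(\<integral>\<omega>\<in>b. f (X \<omega>, Y \<omega>) \<partial>M) = (\<integral>\<omega>\<in>b. g (X \<omega>) \<partial>M)" .
  qed (rule int)
  then show ?thesis
  proof (rule AE_mp, intro AE_I2 impI)
    fix \<omega> assume "\<omega> \<in> space M" "real_cond_exp M (vimage_algebra (space M) X E) (\<lambda>\<omega>. f (X \<omega>, Y \<omega>)) \<omega> = g (X \<omega>)"
    then show "real_cond_exp M (vimage_algebra (space M) X E) (\<lambda>\<omega>. f (X \<omega>, Y \<omega>)) \<omega> = (\<integral>\<omega>'. f (X \<omega>, Y \<omega>') \<partial>M)"
      using g_eq[OF measurable_space[OF indep_generatedD(1)[OF ind]]] by simp
  qed
qed

lemma cond_prob_ind_freeze:
  assumes ind: "indep_generated E X F Y" and A [measurable]: "A \<in> sets (E \<Otimes>\<^sub>M F)"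
  shows "AE \<omega> in M. cond_prob_ind M (vimage_algebra (space M) X E) {\<omega>\<in>space M. (X \<omega>, Y \<omega>) \<in> A} \<omega> =
    prob {\<omega>'\<in>space M. (X \<omega>, Y \<omega>') \<in> A}"
proof -
  note [measurable] = indep_generatedD(1,2)[OF ind]
  interpret sigma_finite_subalgebra M "vimage_algebra (space M) X E"
    by (rule sigma_finite_subalgebra_vimage_algebra) simp
  have eq: "(\<integral>\<omega>'. indicat_real A (x, Y \<omega>') \<partial>M) = prob {\<omega>'\<in>space M. (x, Y \<omega>') \<in> A}" if "x \<in> space E" for x
  proof -
    have [measurable]: "{\<omega>'\<in>space M. (x, Y \<omega>') \<in> A} \<in> events"
      using that by measurable
    have "(\<integral>\<omega>'. indicat_real A (x, Y \<omega>') \<partial>M) = expectation (indicat_real {\<omega>'\<in>space M. (x, Y \<omega>') \<in> A})"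
      by (intro Bochner_Integration.integral_cong) (auto simp: indicator_def)
    then show ?thesis by simp
  qed
  have "AE \<omega> in M. real_cond_exp M (vimage_algebra (space M) X E) (\<lambda>\<omega>. indicat_real A (X \<omega>, Y \<omega>)) \<omega> =
      (\<integral>\<omega>'. indicator A (X \<omega>, Y \<omega>') \<partial>M)"
    by (rule real_cond_exp_freeze[OF ind]) (auto intro!: integrable_const_bound[of _ 1])
  moreover have "AE \<omega> in M. real_cond_exp M (vimage_algebra (space M) X E) (\<lambda>\<omega>. indicat_real A (X \<omega>, Y \<omega>)) \<omega> =
      real_cond_exp M (vimage_algebra (space M) X E) (indicat_real {\<omega>\<in>space M. (X \<omega>, Y \<omega>) \<in> A}) \<omega>"
    by (rule real_cond_exp_cong) (auto simp: indicator_def)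
  ultimately show ?thesis
    unfolding cond_prob_ind_def using AE_space
  proof eventually_elim
    case (elim \<omega>)
    have "X \<omega> \<in> space E" using elim(3) by (rule measurable_space[OF indep_generatedD(1)[OF ind]])
    from eq[OF this] elim(1,2) show ?case by simp
  qed
qed

lemma regular_cond_distr_freeze:
  assumes ind: "indep_generated E X F Y" and h [measurable]: "h \<in> E \<Otimes>\<^sub>M F \<rightarrow>\<^sub>M E'"
    and U: "\<And>\<omega>. \<omega> \<in> space M \<Longrightarrow> U \<omega> = h (X \<omega>, Y \<omega>)"
    and K: "\<And>\<omega>. \<omega> \<in> space M \<Longrightarrow> K \<omega> = distr M E' (\<lambda>\<omega>'. h (X \<omega>, Y \<omega>'))"
  shows "regular_cond_distr M (vimage_algebra (space M) X E) E' U K"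
  unfolding regular_cond_distr_def
proof (intro conjI ballI)
  note [measurable] = indep_generatedD(1,2)[OF ind]
  have "U \<in> M \<rightarrow>\<^sub>M E' \<longleftrightarrow> (\<lambda>\<omega>. h (X \<omega>, Y \<omega>)) \<in> M \<rightarrow>\<^sub>M E'"
    using U by (intro measurable_cong) auto
  then show "random_variable E' U" by simp
  have M_prob: "(\<lambda>_. M) \<in> E \<rightarrow>\<^sub>M prob_algebra M"
    using prob_space_axioms by (intro measurable_const) (simp add: space_prob_algebra)
  have "(\<lambda>x. distr M E' (\<lambda>\<omega>'. h (x, Y \<omega>'))) \<in> E \<rightarrow>\<^sub>M prob_algebra E'"
    by (rule measurable_distr_prob_space2[OF M_prob]) measurable
  then have "(\<lambda>\<omega>. distr M E' (\<lambda>\<omega>'. h (X \<omega>, Y \<omega>'))) \<in> vimage_algebra (space M) X E \<rightarrow>\<^sub>M prob_algebra E'"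
    by (rule measurable_compose[OF measurable_vimage_algebra_self, rotated]) simp
  moreover have "K \<in> vimage_algebra (space M) X E \<rightarrow>\<^sub>M prob_algebra E' \<longleftrightarrow>
      (\<lambda>\<omega>. distr M E' (\<lambda>\<omega>'. h (X \<omega>, Y \<omega>'))) \<in> vimage_algebra (space M) X E \<rightarrow>\<^sub>M prob_algebra E'"
    by (rule measurable_cong) (simp add: K)
  ultimately show "K \<in> vimage_algebra (space M) X E \<rightarrow>\<^sub>M prob_algebra E'" by simp
  fix A assume A [measurable]: "A \<in> sets E'"
  have A1: "AE \<omega> in M. cond_prob_ind M (vimage_algebra (space M) X E)
      {\<omega>\<in>space M. (X \<omega>, Y \<omega>) \<in> h -` A \<inter> space (E \<Otimes>\<^sub>M F)} \<omega> =
      prob {\<omega>'\<in>space M. (X \<omega>, Y \<omega>') \<in> h -` A \<inter> space (E \<Otimes>\<^sub>M F)}"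
    by (rule cond_prob_ind_freeze[OF ind]) measurable
  have U_eq: "{\<omega>\<in>space M. (X \<omega>, Y \<omega>) \<in> h -` A \<inter> space (E \<Otimes>\<^sub>M F)} = U -` A \<inter> space M"
    using U indep_generatedD(1,2)[OF ind, THEN measurable_space] by (auto simp: space_pair_measure)
  have A2: "AE \<omega> in M. prob {\<omega>'\<in>space M. (X \<omega>, Y \<omega>') \<in> h -` A \<inter> space (E \<Otimes>\<^sub>M F)} = measure (K \<omega>) A"
  proof (rule AE_I2)
    fix \<omega> assume that: "\<omega> \<in> space M"
    have X\<omega> [measurable]: "X \<omega> \<in> space E" using that by (rule measurable_space[OF indep_generatedD(1)[OF ind]])
    have "measure (K \<omega>) A = prob ((\<lambda>\<omega>'. h (X \<omega>, Y \<omega>')) -` A \<inter> space M)"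
      unfolding K[OF that] by (rule measure_distr) measurable
    also have "(\<lambda>\<omega>'. h (X \<omega>, Y \<omega>')) -` A \<inter> space M = {\<omega>'\<in>space M. (X \<omega>, Y \<omega>') \<in> h -` A \<inter> space (E \<Otimes>\<^sub>M F)}"
      using X\<omega> indep_generatedD(2)[OF ind, THEN measurable_space] by (auto simp: space_pair_measure)
    finally show "prob {\<omega>'\<in>space M. (X \<omega>, Y \<omega>') \<in> h -` A \<inter> space (E \<Otimes>\<^sub>M F)} = measure (K \<omega>) A" by simp
  qed
  show "AE \<omega> in M. cond_prob_ind M (vimage_algebra (space M) X E) (U -` A \<inter> space M) \<omega> = measure (K \<omega>) A"
    using A1 A2 unfolding U_eq by eventually_elim simp
qed

lemma real_cond_exp_freeze_kernel:
  fixes r :: "'d \<Rightarrow> real"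
  assumes ind: "indep_generated E X F Y" and h [measurable]: "h \<in> E \<Otimes>\<^sub>M F \<rightarrow>\<^sub>M E'"
    and U: "\<And>\<omega>. \<omega> \<in> space M \<Longrightarrow> U \<omega> = h (X \<omega>, Y \<omega>)"
    and K: "\<And>\<omega>. \<omega> \<in> space M \<Longrightarrow> K \<omega> = distr M E' (\<lambda>\<omega>'. h (X \<omega>, Y \<omega>'))"
    and r [measurable]: "r \<in> borel_measurable E'" and int: "integrable M (\<lambda>\<omega>. r (U \<omega>))"
  shows "AE \<omega> in M. real_cond_exp M (vimage_algebra (space M) X E) (\<lambda>\<omega>. r (U \<omega>)) \<omega> = (\<integral>t. r t \<partial>K \<omega>)"
proof -
  note [measurable] = indep_generatedD(1,2)[OF ind]
  interpret sigma_finite_subalgebra M "vimage_algebra (space M) X E"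
    by (rule sigma_finite_subalgebra_vimage_algebra) simp
  have int': "integrable M (\<lambda>\<omega>. r (h (X \<omega>, Y \<omega>)))"
    using int U by (simp cong: Bochner_Integration.integrable_cong)
  have "AE \<omega> in M. real_cond_exp M (vimage_algebra (space M) X E) (\<lambda>\<omega>. r (h (X \<omega>, Y \<omega>))) \<omega> =
      (\<integral>\<omega>'. r (h (X \<omega>, Y \<omega>')) \<partial>M)"
    by (rule real_cond_exp_freeze[OF ind _ int']) measurable
  moreover have "AE \<omega> in M. real_cond_exp M (vimage_algebra (space M) X E) (\<lambda>\<omega>. r (U \<omega>)) \<omega> =
      real_cond_exp M (vimage_algebra (space M) X E) (\<lambda>\<omega>. r (h (X \<omega>, Y \<omega>))) \<omega>"
    using int int' U by (intro real_cond_exp_cong) auto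
  moreover have "AE \<omega> in M. (\<integral>\<omega>'. r (h (X \<omega>, Y \<omega>')) \<partial>M) = (\<integral>t. r t \<partial>K \<omega>)"
  proof (rule AE_I2)
    fix \<omega> assume that: "\<omega> \<in> space M"
    have [measurable]: "X \<omega> \<in> space E" using that by (rule measurable_space[OF indep_generatedD(1)[OF ind]])
    show "(\<integral>\<omega>'. r (h (X \<omega>, Y \<omega>')) \<partial>M) = (\<integral>t. r t \<partial>K \<omega>)"
      unfolding K[OF that] by (rule integral_distr[symmetric]) measurable
  qed
  ultimately show ?thesis
    by eventually_elim simp
qed

text \<open>
  Once \<open>X\<close> is frozen, each \<open>U i\<close> is a function of \<open>Y i\<close> alone, so the independence of the \<open>Y i\<close> gives the
  product formula pointwise in the value of \<open>X\<close>.
\<close>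

lemma cond_indep_vars_freeze:
  fixes Y :: "'i \<Rightarrow> 'a \<Rightarrow> real"
  assumes ind: "indep_generated E X (Pi\<^sub>M I (\<lambda>_. borel)) (\<lambda>\<omega>. \<lambda>i\<in>I. Y i \<omega>)"
    and indY: "indep_vars (\<lambda>_. borel) Y I"
    and h: "\<And>i. i \<in> I \<Longrightarrow> h i \<in> E \<Otimes>\<^sub>M borel \<rightarrow>\<^sub>M E' i"
    and U: "\<And>i \<omega>. i \<in> I \<Longrightarrow> \<omega> \<in> space M \<Longrightarrow> U i \<omega> = h i (X \<omega>, Y i \<omega>)"
  shows "cond_indep_vars M (vimage_algebra (space M) X E) E' U I"
  unfolding cond_indep_vars_def
proof (intro conjI ballI allI impI)
  note [measurable] = indep_generatedD(1)[OF ind]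
  have Y [measurable]: "random_variable borel (Y i)" if "i \<in> I" for i
    using indY that by (auto simp: indep_vars_def)
  show "random_variable (E' i) (U i)" if "i \<in> I" for i
  proof -
    note [measurable] = h[OF that] Y[OF that]
    have "U i \<in> M \<rightarrow>\<^sub>M E' i \<longleftrightarrow> (\<lambda>\<omega>. h i (X \<omega>, Y i \<omega>)) \<in> M \<rightarrow>\<^sub>M E' i"
      using U[OF that] by (intro measurable_cong) auto
    then show ?thesis by simp
  qed
  fix J B assume J: "J \<subseteq> I" "J \<noteq> {}" "finite J" and B: "\<forall>j\<in>J. B j \<in> sets (E' j)"
  let ?F = "vimage_algebra (space M) X E" and ?P = "Pi\<^sub>M I (\<lambda>_. borel :: real measure)"
  define C where "C j = {p \<in> space (E \<Otimes>\<^sub>M ?P). h j (fst p, snd p j) \<in> B j}" for j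
  have C [measurable]: "C j \<in> sets (E \<Otimes>\<^sub>M ?P)" if "j \<in> J" for j
  proof -
    have [measurable]: "h j \<in> E \<Otimes>\<^sub>M borel \<rightarrow>\<^sub>M E' j" "B j \<in> sets (E' j)" and "j \<in> I"
      using h B J that by auto
    have [measurable]: "(\<lambda>p. snd p j) \<in> E \<Otimes>\<^sub>M ?P \<rightarrow>\<^sub>M borel"
      using \<open>j \<in> I\<close> by (intro measurable_compose[OF measurable_snd measurable_component_singleton])
    show ?thesis unfolding C_def by measurable
  qed
  have mem_C: "(X \<omega>, \<lambda>i\<in>I. Y i \<omega>') \<in> C j \<longleftrightarrow> h j (X \<omega>, Y j \<omega>') \<in> B j"
    if "j \<in> J" "\<omega> \<in> space M" "\<omega>' \<in> space M" for j \<omega> \<omega>'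
    using that J indep_generatedD(1,2)[OF ind, THEN measurable_space]
    by (auto simp: C_def space_pair_measure)
  have single: "AE \<omega> in M. cond_prob_ind M ?F (U j -` B j \<inter> space M) \<omega> =
      prob {\<omega>'\<in>space M. h j (X \<omega>, Y j \<omega>') \<in> B j}" if "j \<in> J" for j
    using cond_prob_ind_freeze[OF ind C[OF that]] AE_space
  proof eventually_elim
    case (elim \<omega>)
    have "{\<omega>\<in>space M. (X \<omega>, \<lambda>i\<in>I. Y i \<omega>) \<in> C j} = U j -` B j \<inter> space M"
      using that J U mem_C by auto
    moreover have "{\<omega>'\<in>space M. (X \<omega>, \<lambda>i\<in>I. Y i \<omega>') \<in> C j} = {\<omega>'\<in>space M. h j (X \<omega>, Y j \<omega>') \<in> B j}"
      using mem_C[OF that elim(2)] by auto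
    ultimately show ?case using elim(1) by simp
  qed
  have joint_sets: "(\<Inter>j\<in>J. C j) \<in> sets (E \<Otimes>\<^sub>M ?P)"
    using J C by (intro sets.finite_INT) auto
  have joint: "AE \<omega> in M. cond_prob_ind M ?F (\<Inter>j\<in>J. U j -` B j \<inter> space M) \<omega> =
      prob {\<omega>'\<in>space M. \<forall>j\<in>J. h j (X \<omega>, Y j \<omega>') \<in> B j}"
    using cond_prob_ind_freeze[OF ind joint_sets] AE_space
  proof eventually_elim
    case (elim \<omega>)
    have "{\<omega>\<in>space M. (X \<omega>, \<lambda>i\<in>I. Y i \<omega>) \<in> (\<Inter>j\<in>J. C j)} = (\<Inter>j\<in>J. U j -` B j \<inter> space M)"
    proof -
      have "\<omega> \<in> space M \<and> (\<forall>j\<in>J. (X \<omega>, \<lambda>i\<in>I. Y i \<omega>) \<in> C j) \<longleftrightarrow> \<omega> \<in> space M \<and> (\<forall>j\<in>J. U j \<omega> \<in> B j)" for \<omega>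
        using mem_C[of _ \<omega> \<omega>] U[of _ \<omega>] J(1) by (auto simp: subset_iff)
      then show ?thesis using J(2) by auto
    qed
    moreover have "{\<omega>'\<in>space M. (X \<omega>, \<lambda>i\<in>I. Y i \<omega>') \<in> (\<Inter>j\<in>J. C j)} = {\<omega>'\<in>space M. \<forall>j\<in>J. h j (X \<omega>, Y j \<omega>') \<in> B j}"
      using mem_C[OF _ elim(2)] by auto
    ultimately show ?case using elim(1) by simp
  qed
  have prod: "prob {\<omega>'\<in>space M. \<forall>j\<in>J. h j (x, Y j \<omega>') \<in> B j} =
      (\<Prod>j\<in>J. prob {\<omega>'\<in>space M. h j (x, Y j \<omega>') \<in> B j})" if x: "x \<in> space E" for x
  proof -
    have "indep_vars E' (\<lambda>j \<omega>'. h j (x, Y j \<omega>')) J"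
    proof (rule indep_vars_compose2[OF indep_vars_subset[OF indY J(1)]])
      show "(\<lambda>y. h j (x, y)) \<in> borel \<rightarrow>\<^sub>M E' j" if "j \<in> J" for j
        using h[of j] that J x by (auto intro: measurable_Pair2)
    qed
    then have "prob (\<Inter>j\<in>J. (\<lambda>\<omega>'. h j (x, Y j \<omega>')) -` B j \<inter> space M) =
        (\<Prod>j\<in>J. prob ((\<lambda>\<omega>'. h j (x, Y j \<omega>')) -` B j \<inter> space M))"
      by (rule indep_varsD) (use J B in auto)
    moreover have "(\<Inter>j\<in>J. (\<lambda>\<omega>'. h j (x, Y j \<omega>')) -` B j \<inter> space M) = {\<omega>'\<in>space M. \<forall>j\<in>J. h j (x, Y j \<omega>') \<in> B j}"
      using J by auto
    moreover have "(\<lambda>\<omega>'. h j (x, Y j \<omega>')) -` B j \<inter> space M = {\<omega>'\<in>space M. h j (x, Y j \<omega>') \<in> B j}" for j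
      by auto
    ultimately show ?thesis by simp
  qed
  have "AE \<omega> in M. \<forall>j\<in>J. cond_prob_ind M ?F (U j -` B j \<inter> space M) \<omega> =
      prob {\<omega>'\<in>space M. h j (X \<omega>, Y j \<omega>') \<in> B j}"
    using J single by (intro AE_finite_allI) auto
  with joint show "AE \<omega> in M. cond_prob_ind M ?F (\<Inter>j\<in>J. U j -` B j \<inter> space M) \<omega> =
      (\<Prod>j\<in>J. cond_prob_ind M ?F (U j -` B j \<inter> space M) \<omega>)"
    using AE_space
  proof eventually_elim
    case (elim \<omega>)
    have "X \<omega> \<in> space E" using elim(3) by (rule measurable_space[OF indep_generatedD(1)[OF ind]])
    from prod[OF this] elim(1,2) show ?case by simp
  qed
qed

text \<open>
  Freezing gives the same function of \<open>p (Z \<omega>)\<close> whether one conditions on \<open>Z\<close> or on \<open>p (Z)\<close>, because \<open>f\<close>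
  depends on \<open>Z\<close> through \<open>p\<close> only. The tower property from \<open>Z\<close> down to \<open>q (Z)\<close> then gives the claim.
\<close>

lemma real_cond_exp_markov:
  fixes f :: "'c \<times> 'd \<Rightarrow> real"
  assumes ind: "indep_generated E Z F Y"
    and p [measurable]: "p \<in> E \<rightarrow>\<^sub>M E1" and q [measurable]: "q \<in> E \<rightarrow>\<^sub>M E0"
    and f [measurable]: "f \<in> borel_measurable (E1 \<Otimes>\<^sub>M F)" and int: "integrable M (\<lambda>\<omega>. f (p (Z \<omega>), Y \<omega>))"
  shows "AE \<omega> in M. real_cond_exp M (vimage_algebra (space M) (\<lambda>\<omega>. q (Z \<omega>)) E0) (\<lambda>\<omega>. f (p (Z \<omega>), Y \<omega>)) \<omega> =
    real_cond_exp M (vimage_algebra (space M) (\<lambda>\<omega>. q (Z \<omega>)) E0)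
      (real_cond_exp M (vimage_algebra (space M) (\<lambda>\<omega>. p (Z \<omega>)) E1) (\<lambda>\<omega>. f (p (Z \<omega>), Y \<omega>))) \<omega>"
proof -
  note [measurable] = indep_generatedD(1,2)[OF ind]
  let ?FZ = "vimage_algebra (space M) Z E"
  let ?F0 = "vimage_algebra (space M) (\<lambda>\<omega>. q (Z \<omega>)) E0" and ?F1 = "vimage_algebra (space M) (\<lambda>\<omega>. p (Z \<omega>)) E1"
  interpret F0: sigma_finite_subalgebra M ?F0 by (rule sigma_finite_subalgebra_vimage_algebra) simp
  have Z: "Z \<in> ?FZ \<rightarrow>\<^sub>M E" by (rule measurable_vimage_algebra_self) simp
  have "subalgebra ?FZ ?F0"
    unfolding subalgebra_def
  proof
    have "(\<lambda>\<omega>. q (Z \<omega>)) \<in> ?FZ \<rightarrow>\<^sub>M E0" using Z by simp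
    then show "sets ?F0 \<subseteq> sets ?FZ"
      by (subst sets_vimage_algebra_random_variable) (auto dest: measurable_sets)
  qed simp
  then have nested: "AE \<omega> in M. real_cond_exp M ?F0 (real_cond_exp M ?FZ (\<lambda>\<omega>. f (p (Z \<omega>), Y \<omega>))) \<omega> =
      real_cond_exp M ?F0 (\<lambda>\<omega>. f (p (Z \<omega>), Y \<omega>)) \<omega>"
    by (intro F0.real_cond_exp_nested_subalg subalgebra_vimage_algebra int) simp
  have "AE \<omega> in M. real_cond_exp M ?FZ (\<lambda>\<omega>. f (p (Z \<omega>), Y \<omega>)) \<omega> = (\<integral>\<omega>'. f (p (Z \<omega>), Y \<omega>') \<partial>M)"
    using real_cond_exp_freeze[OF ind, of "\<lambda>z. f (p (fst z), snd z)"] int by simp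
  moreover have "AE \<omega> in M. real_cond_exp M ?F1 (\<lambda>\<omega>. f (p (Z \<omega>), Y \<omega>)) \<omega> = (\<integral>\<omega>'. f (p (Z \<omega>), Y \<omega>') \<partial>M)"
    by (rule real_cond_exp_freeze[OF indep_generated_compose[OF ind p] f int])
  ultimately have "AE \<omega> in M. real_cond_exp M ?FZ (\<lambda>\<omega>. f (p (Z \<omega>), Y \<omega>)) \<omega> = real_cond_exp M ?F1 (\<lambda>\<omega>. f (p (Z \<omega>), Y \<omega>)) \<omega>"
    by eventually_elim simp
  then have "AE \<omega> in M. real_cond_exp M ?F0 (real_cond_exp M ?FZ (\<lambda>\<omega>. f (p (Z \<omega>), Y \<omega>))) \<omega> =
      real_cond_exp M ?F0 (real_cond_exp M ?F1 (\<lambda>\<omega>. f (p (Z \<omega>), Y \<omega>))) \<omega>"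
    by (rule F0.real_cond_exp_cong) auto
  with nested show ?thesis
    by eventually_elim simp
qed

end

section \<open>Geometry of the zigzag levels\<close>

lemma zigzag_even: "zigzag N (2 * k) = (- int k, - int N + int k)"
  by (simp add: zigzag_def Let_def)

lemma zigzag_odd: "zigzag N (2 * k + 1) = (- int k - 1, - int N + int k)"
  by (simp add: zigzag_def Let_def)

lemma zigzag_sum: "fst (zigzag N j) + snd (zigzag N j) = (if even j then - int N else - int N - 1)"
  by (simp add: zigzag_def Let_def)

lemma mem_\<Gamma>_iff:
  "x \<in> \<Gamma> N \<longleftrightarrow> fst x \<le> 0 \<and> snd x \<le> 0 \<and> (fst x + snd x = - int N \<or> fst x + snd x = - int N - 1) \<and>
     x \<noteq> (0, - int N - 1) \<and> x \<noteq> (- int N - 1, 0)"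
proof -
  obtain a b where x: "x = (a, b)" by (cases x)
  have neg: "y \<in> uminus ` A \<longleftrightarrow> - y \<in> A" for y and A :: "(int \<times> int) set"
    by (auto intro: image_eqI[of y uminus "- y"])
  show ?thesis
    unfolding x \<Gamma>_def Diff_iff neg L_def by auto
qed

text \<open>
  The corners removed from \<open>\<Gamma> l\<close> belong to \<open>\<Gamma> (l + 1)\<close>, so only the corners of the last level are
  missing from the union.
\<close>

lemma mem_\<Delta>_iff:
  "x \<in> \<Delta> N \<longleftrightarrow> fst x \<le> 0 \<and> snd x \<le> 0 \<and> - int N - 1 \<le> fst x + snd x \<and>
     x \<noteq> (0, - int N - 1) \<and> x \<noteq> (- int N - 1, 0)"
proof
  assume "x \<in> \<Delta> N"
  then obtain l where "l \<le> N" "x \<in> \<Gamma> l" by (auto simp: \<Delta>_def)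
  then show "fst x \<le> 0 \<and> snd x \<le> 0 \<and> - int N - 1 \<le> fst x + snd x \<and>
     x \<noteq> (0, - int N - 1) \<and> x \<noteq> (- int N - 1, 0)"
    by (cases "l = N") (auto simp: mem_\<Gamma>_iff)
next
  assume *: "fst x \<le> 0 \<and> snd x \<le> 0 \<and> - int N - 1 \<le> fst x + snd x \<and>
     x \<noteq> (0, - int N - 1) \<and> x \<noteq> (- int N - 1, 0)"
  show "x \<in> \<Delta> N"
  proof (cases "fst x + snd x = - int N - 1")
    case True
    then have "x \<in> \<Gamma> N" using * by (auto simp: mem_\<Gamma>_iff)
    then show ?thesis by (auto simp: \<Delta>_def)
  next
    case False
    define l where "l = nat (- fst x - snd x)"
    have "l \<le> N" "x \<in> \<Gamma> l" using * False by (auto simp: l_def mem_\<Gamma>_iff prod_eq_iff)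
    then show ?thesis by (auto simp: \<Delta>_def)
  qed
qed

lemma \<Gamma>_eq_zigzag:
  assumes "x \<in> \<Gamma> N"
  obtains j where "j \<le> 2 * N" "x = zigzag N j"
proof (cases "fst x + snd x = - int N")
  case True
  define k where "k = nat (- fst x)"
  have "2 * k \<le> 2 * N" "x = zigzag N (2 * k)"
    using assms True by (auto simp: mem_\<Gamma>_iff zigzag_even k_def prod_eq_iff)
  then show thesis by (rule that)
next
  case False
  then have sum: "fst x + snd x = - int N - 1" using assms by (auto simp: mem_\<Gamma>_iff)
  have "fst x \<noteq> 0" "snd x \<noteq> 0" using assms sum by (auto simp: mem_\<Gamma>_iff prod_eq_iff)
  define k where "k = nat (- fst x - 1)"
  have "2 * k + 1 \<le> 2 * N" "x = zigzag N (2 * k + 1)"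
    using assms sum \<open>fst x \<noteq> 0\<close> \<open>snd x \<noteq> 0\<close> unfolding zigzag_odd by (auto simp: mem_\<Gamma>_iff k_def prod_eq_iff)
  then show thesis by (rule that)
qed

lemma finite_\<Delta>: "finite (\<Delta> N)"
proof (rule finite_subset)
  show "\<Delta> N \<subseteq> {- int N - 1..0} \<times> {- int N - 1..0}" by (auto simp: mem_\<Delta>_iff)
qed simp

text \<open>
  The sites of coordinate sum \<open>- n - 1\<close> in \<open>\<Delta> (n + 1)\<close> that are missing from \<open>\<Delta> n\<close> are its two corners,
  which are the first and the last site of the next zigzag. The sites of coordinate sum \<open>- n - 2\<close> are
  its odd entries.
\<close>

lemma prod_\<Delta>_Suc:
  fixes f :: "int \<times> int \<Rightarrow> real"
  shows "(\<Prod>x\<in>\<Delta> (Suc n). f x) = f (zigzag (Suc n) 0) * f (zigzag (Suc n) (2 * Suc n)) *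
    (\<Prod>k<Suc n. f (zigzag (Suc n) (2 * k + 1))) * (\<Prod>x\<in>\<Delta> n. f x)"
proof -
  let ?a = "zigzag (Suc n) 0" and ?b = "zigzag (Suc n) (2 * Suc n)" and ?c = "\<lambda>k. zigzag (Suc n) (2 * k + 1)"
  have a: "?a = (0, - int n - 1)" and b: "?b = (- int n - 1, 0)"
    using zigzag_even[of "Suc n" 0] zigzag_even[of "Suc n" "Suc n"] by (simp_all del: mult_Suc_right)
  have c: "?c k = (- int k - 1, - int n - 1 + int k)" for k
    unfolding zigzag_odd by simp
  have inj: "inj_on ?c {..<Suc n}" unfolding c by (auto simp: inj_on_def)
  have "\<Delta> (Suc n) = insert ?a (insert ?b (?c ` {..<Suc n} \<union> \<Delta> n))"
  proof (rule set_eqI)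
    fix x
    have "x \<in> ?c ` {..<Suc n} \<longleftrightarrow> fst x < 0 \<and> snd x < 0 \<and> fst x + snd x = - int n - 2"
    proof
      assume "fst x < 0 \<and> snd x < 0 \<and> fst x + snd x = - int n - 2"
      then show "x \<in> ?c ` {..<Suc n}" unfolding c
        by (intro image_eqI[of _ _ "nat (- fst x - 1)"]) (auto simp: prod_eq_iff)
    next
      assume "x \<in> ?c ` {..<Suc n}"
      then obtain k where "x = ?c k" "k < Suc n" by auto
      then show "fst x < 0 \<and> snd x < 0 \<and> fst x + snd x = - int n - 2" unfolding c by simp
    qed
    then show "x \<in> \<Delta> (Suc n) \<longleftrightarrow> x \<in> insert ?a (insert ?b (?c ` {..<Suc n} \<union> \<Delta> n))"
      unfolding insert_iff Un_iff a b mem_\<Delta>_iff prod_eq_iff fst_conv snd_conv of_nat_Suc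
      by (simp only:) presburger
  qed
  moreover have "?a \<notin> insert ?b (?c ` {..<Suc n} \<union> \<Delta> n)" "?b \<notin> ?c ` {..<Suc n} \<union> \<Delta> n"
    "?c ` {..<Suc n} \<inter> \<Delta> n = {}"
    unfolding a b c by (auto simp: mem_\<Delta>_iff)
  ultimately show ?thesis
    using finite_\<Delta>[of n] inj by (simp add: prod.union_disjoint prod.reindex mult.assoc del: mult_Suc_right)
qed

section \<open>Innovations of the Pickard field\<close>

locale pickard = prob_space M for M :: "'a measure" +
  fixes \<mu> \<rho>\<^sub>1 \<rho>\<^sub>2 :: real and \<xi> :: "int \<times> int \<Rightarrow> 'a \<Rightarrow> real"
  assumes field: "pickard_field M \<mu> \<rho>\<^sub>1 \<rho>\<^sub>2 \<xi>"
    and \<rho>: "0 < \<rho>\<^sub>1" "\<rho>\<^sub>1 < 1" "0 < \<rho>\<^sub>2" "\<rho>\<^sub>2 < 1"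
begin

definition \<sigma> :: "int \<times> int \<Rightarrow> 'a \<Rightarrow> real" where
  "\<sigma> x \<omega> = \<xi> x \<omega> - \<mu>"

definition field_span :: "('a \<Rightarrow> real) set" where
  "field_span = {\<lambda>\<omega>. \<Sum>x\<in>S. c x * \<sigma> x \<omega> | S c. finite S}"

lemma gaussian_rv_sum_\<xi>: "finite S \<Longrightarrow> gaussian_rv M (\<lambda>\<omega>. \<Sum>x\<in>S. c x * \<xi> x \<omega>)"
  using field by (simp add: pickard_field_def gaussian_field_def)

lemma integrable_\<xi>: "integrable M (\<xi> x)"
  using integrable_gaussian_rv[OF gaussian_rv_sum_\<xi>[of "{x}" "\<lambda>_. 1"]] by simp

lemma expectation_\<xi>: "expectation (\<xi> x) = \<mu>"
  by (rule field[unfolded pickard_field_def, THEN conjunct2, THEN conjunct1, rule_format])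

lemma field_spanI: "finite S \<Longrightarrow> (\<lambda>\<omega>. \<Sum>x\<in>S. c x * \<sigma> x \<omega>) \<in> field_span"
  by (auto simp: field_span_def)

lemma gaussian_rv_sum_\<sigma>:
  assumes "finite S"
  shows "gaussian_rv M (\<lambda>\<omega>. \<Sum>x\<in>S. c x * \<sigma> x \<omega>)"
proof -
  from gaussian_rv_add_const[OF gaussian_rv_sum_\<xi>[OF assms, of c], of "- (\<Sum>x\<in>S. c x * \<mu>)"]
  show ?thesis by (simp add: \<sigma>_def right_diff_distrib sum_subtractf)
qed

sublocale centered_gaussian_space M field_span
proof
  show "(\<lambda>_. 0) \<in> field_span"
    unfolding field_span_def by (intro CollectI exI[of _ "{}"]) simp
  fix X Y assume "X \<in> field_span" "Y \<in> field_span"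
  then obtain S c T d where S: "finite S" "X = (\<lambda>\<omega>. \<Sum>x\<in>S. c x * \<sigma> x \<omega>)"
    and T: "finite T" "Y = (\<lambda>\<omega>. \<Sum>x\<in>T. d x * \<sigma> x \<omega>)"
    unfolding field_span_def by blast
  have "X \<omega> = (\<Sum>x\<in>S \<union> T. (if x \<in> S then c x else 0) * \<sigma> x \<omega>)" for \<omega>
    unfolding S(2) using S(1) T(1) by (intro sum.mono_neutral_cong_left) auto
  moreover have "Y \<omega> = (\<Sum>x\<in>S \<union> T. (if x \<in> T then d x else 0) * \<sigma> x \<omega>)" for \<omega>
    unfolding T(2) using S(1) T(1) by (intro sum.mono_neutral_cong_left) auto
  ultimately have "(\<lambda>\<omega>. X \<omega> + Y \<omega>) =
      (\<lambda>\<omega>. \<Sum>x\<in>S \<union> T. ((if x \<in> S then c x else 0) + (if x \<in> T then d x else 0)) * \<sigma> x \<omega>)"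
    by (simp only: sum.distrib distrib_right)
  moreover have "\<dots> \<in> field_span"
    by (rule field_spanI) (use S(1) T(1) in simp)
  ultimately show "(\<lambda>\<omega>. X \<omega> + Y \<omega>) \<in> field_span" by simp
next
  fix X c assume "X \<in> field_span"
  then obtain S d where S: "finite S" "X = (\<lambda>\<omega>. \<Sum>x\<in>S. d x * \<sigma> x \<omega>)"
    unfolding field_span_def by blast
  have "(\<lambda>\<omega>. c * X \<omega>) = (\<lambda>\<omega>. \<Sum>x\<in>S. (c * d x) * \<sigma> x \<omega>)"
    unfolding S(2) by (simp add: sum_distrib_left mult.assoc)
  moreover have "\<dots> \<in> field_span"
    by (rule field_spanI) (rule S(1))
  ultimately show "(\<lambda>\<omega>. c * X \<omega>) \<in> field_span" by simp
next
  fix X assume "X \<in> field_span"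
  then obtain S c where S: "finite S" "X = (\<lambda>\<omega>. \<Sum>x\<in>S. c x * \<sigma> x \<omega>)"
    unfolding field_span_def by blast
  then show "gaussian_rv M X" using gaussian_rv_sum_\<sigma> by simp
  show "expectation X = 0"
    unfolding S(2) \<sigma>_def using integrable_\<xi> expectation_\<xi>
    by (subst Bochner_Integration.integral_sum) (auto simp: prob_space)
qed

lemma \<sigma>_mem: "\<sigma> x \<in> field_span"
  using field_spanI[of "{x}" "\<lambda>_. 1"] by simp

lemma expectation_\<sigma>_\<sigma>:
  "expectation (\<lambda>\<omega>. \<sigma> x \<omega> * \<sigma> y \<omega>) = \<rho>\<^sub>1 ^ nat \<bar>fst x - fst y\<bar> * \<rho>\<^sub>2 ^ nat \<bar>snd x - snd y\<bar>"
proof -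
  have "covariance M (\<xi> x) (\<xi> y) = expectation (\<lambda>\<omega>. \<sigma> x \<omega> * \<sigma> y \<omega>)"
    unfolding covariance_def expectation_\<xi> \<sigma>_def ..
  then show ?thesis
    using field[unfolded pickard_field_def, THEN conjunct2, THEN conjunct2, rule_format, of x y] by simp
qed

text \<open>
  Applying \<open>1 - \<rho>\<^sub>1 S\<^sub>1\<close> and \<open>1 - \<rho>\<^sub>2 S\<^sub>2\<close>, where \<open>S\<^sub>k\<close> is the backward shift in coordinate \<open>k\<close>, turns the field
  into white noise.
\<close>

definition innov :: "int \<times> int \<Rightarrow> 'a \<Rightarrow> real" where
  "innov x \<omega> = \<sigma> x \<omega> - \<rho>\<^sub>1 * \<sigma> (fst x - 1, snd x) \<omega> - \<rho>\<^sub>2 * \<sigma> (fst x, snd x - 1) \<omega>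
    + \<rho>\<^sub>1 * \<rho>\<^sub>2 * \<sigma> (fst x - 1, snd x - 1) \<omega>"

lemma innov_mem: "innov x \<in> field_span"
proof -
  have "innov x = (\<lambda>\<omega>. (\<sigma> x \<omega> + (- \<rho>\<^sub>1) * \<sigma> (fst x - 1, snd x) \<omega>) +
      ((- \<rho>\<^sub>2) * \<sigma> (fst x, snd x - 1) \<omega> + (\<rho>\<^sub>1 * \<rho>\<^sub>2) * \<sigma> (fst x - 1, snd x - 1) \<omega>))"
    by (simp add: innov_def fun_eq_iff)
  then show ?thesis
    by (simp only: add_mem scale_mem \<sigma>_mem)
qed

lemma expectation_innov_mult:
  assumes "V \<in> field_span"
  shows "expectation (\<lambda>\<omega>. innov x \<omega> * V \<omega>) = expectation (\<lambda>\<omega>. \<sigma> x \<omega> * V \<omega>)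
    - \<rho>\<^sub>1 * expectation (\<lambda>\<omega>. \<sigma> (fst x - 1, snd x) \<omega> * V \<omega>)
    - \<rho>\<^sub>2 * expectation (\<lambda>\<omega>. \<sigma> (fst x, snd x - 1) \<omega> * V \<omega>)
    + \<rho>\<^sub>1 * \<rho>\<^sub>2 * expectation (\<lambda>\<omega>. \<sigma> (fst x - 1, snd x - 1) \<omega> * V \<omega>)"
proof -
  have [simp]: "integrable M (\<lambda>\<omega>. \<sigma> y \<omega> * V \<omega>)" for y
    by (rule integrable_mult[OF \<sigma>_mem assms])
  have "(\<lambda>\<omega>. innov x \<omega> * V \<omega>) = (\<lambda>\<omega>. \<sigma> x \<omega> * V \<omega> - \<rho>\<^sub>1 * (\<sigma> (fst x - 1, snd x) \<omega> * V \<omega>)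
      - \<rho>\<^sub>2 * (\<sigma> (fst x, snd x - 1) \<omega> * V \<omega>) + (\<rho>\<^sub>1 * \<rho>\<^sub>2) * (\<sigma> (fst x - 1, snd x - 1) \<omega> * V \<omega>))"
    by (simp add: innov_def fun_eq_iff algebra_simps)
  then show ?thesis by simp
qed

text \<open>
  The covariance of the field is a product over the two coordinates, and so is that of the filtered
  field with the field.
\<close>

lemma expectation_innov_\<sigma>:
  "expectation (\<lambda>\<omega>. innov x \<omega> * \<sigma> y \<omega>) =
    (\<rho>\<^sub>1 ^ nat \<bar>fst x - fst y\<bar> - \<rho>\<^sub>1 * \<rho>\<^sub>1 ^ nat \<bar>fst x - 1 - fst y\<bar>) *
    (\<rho>\<^sub>2 ^ nat \<bar>snd x - snd y\<bar> - \<rho>\<^sub>2 * \<rho>\<^sub>2 ^ nat \<bar>snd x - 1 - snd y\<bar>)"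
  unfolding expectation_innov_mult[OF \<sigma>_mem] expectation_\<sigma>_\<sigma> fst_conv snd_conv
  by (simp add: algebra_simps)

text \<open>
  In a coordinate where \<open>x\<close> exceeds \<open>y\<close>, the shift lowers the distance by one, and the two terms of
  that factor cancel.
\<close>

lemma expectation_innov_\<sigma>_eq_0:
  assumes "fst y < fst x \<or> snd y < snd x"
  shows "expectation (\<lambda>\<omega>. innov x \<omega> * \<sigma> y \<omega>) = 0"
proof -
  have 0: "r ^ nat \<bar>m - n\<bar> - r * r ^ nat \<bar>m - 1 - n\<bar> = 0" if "n < m" for r :: real and m n :: int
  proof -
    have "nat \<bar>m - n\<bar> = Suc (nat \<bar>m - 1 - n\<bar>)" using that by simp
    then show ?thesis by (simp only: power_Suc diff_self)
  qed
  from assms show ?thesis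
    unfolding expectation_innov_\<sigma> using 0 by (elim disjE) (simp_all only: mult_zero_left mult_zero_right)
qed

text \<open>
  One of the two sites exceeds the other in some coordinate. Its innovation is orthogonal to all four
  field values that make up the other innovation.
\<close>

lemma expectation_innov_innov_eq_0:
  assumes "x \<noteq> y"
  shows "expectation (\<lambda>\<omega>. innov x \<omega> * innov y \<omega>) = 0"
proof -
  have *: "expectation (\<lambda>\<omega>. innov x \<omega> * innov y \<omega>) = 0" if "fst x < fst y \<or> snd x < snd y" for x y
  proof -
    have "expectation (\<lambda>\<omega>. \<sigma> z \<omega> * innov y \<omega>) = 0" if "fst z < fst y \<or> snd z < snd y" for z
      using expectation_innov_\<sigma>_eq_0[OF that] by (simp only: mult.commute)
    then show ?thesis
      unfolding expectation_innov_mult[OF innov_mem] using that by auto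
  qed
  show ?thesis
  proof (cases "fst x < fst y \<or> snd x < snd y")
    case False
    then have "fst y < fst x \<or> snd y < snd x" using assms by (auto simp: prod_eq_iff)
    from *[OF this] show ?thesis by (simp only: mult.commute)
  qed (rule *)
qed

lemma expectation_innov_innov: "expectation (\<lambda>\<omega>. innov x \<omega> * innov x \<omega>) = (1 - \<rho>\<^sub>1\<^sup>2) * (1 - \<rho>\<^sub>2\<^sup>2)"
proof -
  have 0: "expectation (\<lambda>\<omega>. \<sigma> z \<omega> * innov x \<omega>) = 0" if "fst z < fst x \<or> snd z < snd x" for z
    using expectation_innov_\<sigma>_eq_0[OF that] by (simp only: mult.commute)
  have "expectation (\<lambda>\<omega>. innov x \<omega> * innov x \<omega>) = expectation (\<lambda>\<omega>. \<sigma> x \<omega> * innov x \<omega>)"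
    unfolding expectation_innov_mult[OF innov_mem] by (simp add: 0)
  also have "\<dots> = expectation (\<lambda>\<omega>. innov x \<omega> * \<sigma> x \<omega>)"
    by (simp only: mult.commute)
  also have "\<dots> = (1 - \<rho>\<^sub>1\<^sup>2) * (1 - \<rho>\<^sub>2\<^sup>2)"
    unfolding expectation_innov_\<sigma> by (simp add: power2_eq_square)
  finally show ?thesis .
qed

lemma variance_pos: "0 < (1 - \<rho>\<^sub>1\<^sup>2) * (1 - \<rho>\<^sub>2\<^sup>2)"
  using \<rho> by (simp add: abs_square_less_1)

lemma distr_add_innov:
  "distr M borel (\<lambda>\<omega>. m + innov x \<omega>) =
    density lborel (normal_density m (sqrt ((1 - \<rho>\<^sub>1\<^sup>2) * (1 - \<rho>\<^sub>2\<^sup>2))))"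
proof -
  define s where "s = sqrt ((1 - \<rho>\<^sub>1\<^sup>2) * (1 - \<rho>\<^sub>2\<^sup>2))"
  have s: "s > 0" "(1 - \<rho>\<^sub>1\<^sup>2) * (1 - \<rho>\<^sub>2\<^sup>2) = s\<^sup>2"
    using variance_pos by (auto simp: s_def)
  have "distributed M lborel (innov x) (normal_density 0 s)"
    by (rule distributed_mem[OF innov_mem _ s(1)]) (simp add: expectation_innov_innov s(2))
  then have "distributed M lborel (\<lambda>\<omega>. m + 1 * innov x \<omega>) (normal_density (m + 1 * 0) (\<bar>1\<bar> * s))"
    by (rule normal_density_affine) (use s in auto)
  then have "distr M lborel (\<lambda>\<omega>. m + innov x \<omega>) = density lborel (normal_density m s)"
    by (simp add: distributed_def)
  moreover have "distr M lborel (\<lambda>\<omega>. m + innov x \<omega>) = distr M borel (\<lambda>\<omega>. m + innov x \<omega>)"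
    by (rule distr_cong) auto
  ultimately show ?thesis by (simp add: s_def)
qed

end

section \<open>Transition between consecutive levels\<close>

text \<open>
  The deterministic part of the transition. The frozen odd entries are treated like the even ones,
  as a function of the next vector plus (zero) noise.
\<close>

definition cond_mean :: "real \<Rightarrow> real \<Rightarrow> (nat \<Rightarrow> real) \<Rightarrow> nat \<Rightarrow> real" where
  "cond_mean \<rho>\<^sub>1 \<rho>\<^sub>2 s j =
     (if even j then \<rho>\<^sub>2 * s j - \<rho>\<^sub>1 * \<rho>\<^sub>2 * s (j + 1) + \<rho>\<^sub>1 * s (j + 2) else s (j + 1))"

lemma measurable_cond_mean:
  assumes "j \<le> 2 * n"
  shows "(\<lambda>s. cond_mean \<rho>\<^sub>1 \<rho>\<^sub>2 s j) \<in> borel_measurable (zspace (Suc n))"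
proof -
  have [measurable]: "(\<lambda>s. s i) \<in> borel_measurable (zspace (Suc n))" if "i \<le> j + 2" for i
    using that assms by (intro measurable_component_singleton) auto
  show ?thesis unfolding cond_mean_def by measurable
qed

context pickard
begin

definition noise :: "nat \<Rightarrow> nat \<Rightarrow> 'a \<Rightarrow> real" where
  "noise n j = (if even j then innov (zigzag n j) else (\<lambda>_. 0))"

lemma noise_mem: "noise n j \<in> field_span"
  by (simp add: noise_def innov_mem zero_mem)

lemma zvec_eq: "zvec \<mu> \<xi> N \<omega> = (\<lambda>j\<in>{..2 * N}. \<sigma> (zigzag N j) \<omega>)"
  by (simp add: zvec_def \<sigma>_def)

text \<open>
  At an even index this is the definition of the innovation solved for the field value: the three
  predecessors of the site \<open>(- k, - n + k)\<close> occupy the positions \<open>2 k\<close>, \<open>2 k + 1\<close> and \<open>2 k + 2\<close> of the next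
  zigzag. A site at an odd index \<open>j\<close> is the site at \<open>j + 1\<close> of the next zigzag.
\<close>

lemma zvec_eq_cond_mean_add_noise:
  "zvec \<mu> \<xi> n \<omega> = (\<lambda>j\<in>{..2 * n}. cond_mean \<rho>\<^sub>1 \<rho>\<^sub>2 (zvec \<mu> \<xi> (Suc n) \<omega>) j + noise n j \<omega>)"
  unfolding zvec_eq
proof (rule restrict_ext)
  fix j assume j: "j \<in> {..2 * n}"
  show "\<sigma> (zigzag n j) \<omega> =
      cond_mean \<rho>\<^sub>1 \<rho>\<^sub>2 (\<lambda>j\<in>{..2 * Suc n}. \<sigma> (zigzag (Suc n) j) \<omega>) j + noise n j \<omega>"
  proof (cases "even j")
    case True
    then obtain k where k: "j = 2 * k" by (elim evenE)
    have le: "2 * k \<le> 2 * Suc n" "2 * k + 1 \<le> 2 * Suc n" "2 * k + 2 \<le> 2 * Suc n" using j k by auto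
    have "2 * k + 2 = 2 * Suc k" by simp
    then have idx: "zigzag (Suc n) (2 * k) = (fst (zigzag n (2 * k)), snd (zigzag n (2 * k)) - 1)"
      "zigzag (Suc n) (2 * k + 1) = (fst (zigzag n (2 * k)) - 1, snd (zigzag n (2 * k)) - 1)"
      "zigzag (Suc n) (2 * k + 2) = (fst (zigzag n (2 * k)) - 1, snd (zigzag n (2 * k)))"
      unfolding zigzag_odd by (simp_all only: zigzag_even) simp_all
    have "noise n (2 * k) = innov (zigzag n (2 * k))" by (simp add: noise_def)
    then show ?thesis
      unfolding k cond_mean_def using le by (simp add: innov_def idx[symmetric])
  next
    case False
    then obtain k where k: "j = 2 * k + 1" by (elim oddE)
    have le: "2 * k + 2 \<le> 2 * Suc n" using j k by simp
    have "2 * k + 2 = 2 * Suc k" by simp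
    then have idx: "zigzag n (2 * k + 1) = zigzag (Suc n) (2 * k + 2)"
      unfolding zigzag_odd by (simp only: zigzag_even) simp
    then show ?thesis
      unfolding k cond_mean_def using le by (simp add: noise_def)
  qed
qed

text \<open>
  A site with smaller coordinate sum is smaller in at least one coordinate, which is what the
  orthogonality of field and innovation requires.
\<close>

lemma indep_generated_\<sigma>_innov:
  fixes x :: "'i \<Rightarrow> int \<times> int" and y :: "'j \<Rightarrow> int \<times> int" and Y :: "'j \<Rightarrow> 'a \<Rightarrow> real"
  assumes "finite I" "finite J"
    and Y: "\<And>j. j \<in> J \<Longrightarrow> Y j = (\<lambda>_. 0) \<or>
      (Y j = innov (y j) \<and> (\<forall>i\<in>I. fst (x i) + snd (x i) < fst (y j) + snd (y j)))"
  shows "indep_generated (Pi\<^sub>M I (\<lambda>_. borel)) (\<lambda>\<omega>. \<lambda>i\<in>I. \<sigma> (x i) \<omega>)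
    (Pi\<^sub>M J (\<lambda>_. borel)) (\<lambda>\<omega>. \<lambda>j\<in>J. Y j \<omega>)"
  unfolding indep_generated_def
proof (intro conjI)
  have Y_mem: "Y j \<in> field_span" if "j \<in> J" for j
    using Y[OF that] by (elim disjE conjE) (simp_all only: innov_mem zero_mem)
  show "random_variable (Pi\<^sub>M I (\<lambda>_. borel)) (\<lambda>\<omega>. \<lambda>i\<in>I. \<sigma> (x i) \<omega>)"
    "random_variable (Pi\<^sub>M J (\<lambda>_. borel)) (\<lambda>\<omega>. \<lambda>j\<in>J. Y j \<omega>)"
    by (intro measurable_restrict measurable_mem \<sigma>_mem Y_mem; assumption)+
  show "indep_set {(\<lambda>\<omega>. \<lambda>i\<in>I. \<sigma> (x i) \<omega>) -` A \<inter> space M | A. A \<in> sets (Pi\<^sub>M I (\<lambda>_. borel))}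
    {(\<lambda>\<omega>. \<lambda>j\<in>J. Y j \<omega>) -` B \<inter> space M | B. B \<in> sets (Pi\<^sub>M J (\<lambda>_. borel))}"
  proof (rule indep_set_if_orthogonal[OF assms(1,2) \<sigma>_mem Y_mem])
    fix i j assume ij: "i \<in> I" "j \<in> J"
    from Y[OF ij(2)] show "expectation (\<lambda>\<omega>. \<sigma> (x i) \<omega> * Y j \<omega>) = 0"
    proof
      assume *: "Y j = innov (y j) \<and> (\<forall>i\<in>I. fst (x i) + snd (x i) < fst (y j) + snd (y j))"
      then have Yj: "Y j = innov (y j)" ..
      have "fst (x i) + snd (x i) < fst (y j) + snd (y j)"
        using * ij(1) by blast
      then have "fst (x i) < fst (y j) \<or> snd (x i) < snd (y j)"
        by linarith
      from expectation_innov_\<sigma>_eq_0[OF this] show ?thesis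
        unfolding Yj by (simp only: mult.commute)
    qed simp
  qed
qed

lemma indep_generated_zvec_noise:
  "indep_generated (zspace (Suc n)) (zvec \<mu> \<xi> (Suc n)) (zspace n) (\<lambda>\<omega>. \<lambda>j\<in>{..2 * n}. noise n j \<omega>)"
  unfolding zvec_eq[abs_def]
  by (rule indep_generated_\<sigma>_innov[where y = "zigzag n"])
    (auto simp: noise_def zigzag_sum)

lemma indep_vars_noise: "indep_vars (\<lambda>_. borel) (noise n) I"
proof (rule indep_vars_if_orthogonal[OF noise_mem])
  fix i j :: nat assume "i \<noteq> j"
  then have "zigzag n i \<noteq> zigzag n j" if "even i" "even j"
    using that by (auto simp: zigzag_even elim!: evenE)
  then show "expectation (\<lambda>\<omega>. noise n i \<omega> * noise n j \<omega>) = 0"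
    using expectation_innov_innov_eq_0[of "zigzag n i" "zigzag n j"] by (simp add: noise_def)
qed

text \<open>
  The product form of the transition law expresses the independence of the noise. The point masses
  at the odd indices are the laws of constants, which are independent of everything.
\<close>

lemma transition_law_eq_distr:
  "transition_law \<rho>\<^sub>1 \<rho>\<^sub>2 (Suc n) s =
    distr M (zspace n) (\<lambda>\<omega>. \<lambda>j\<in>{..2 * n}. cond_mean \<rho>\<^sub>1 \<rho>\<^sub>2 s j + noise n j \<omega>)"
proof -
  have "indep_vars (\<lambda>_. borel) (\<lambda>j \<omega>. cond_mean \<rho>\<^sub>1 \<rho>\<^sub>2 s j + noise n j \<omega>) {..2 * n}"
    by (rule indep_vars_compose2[OF indep_vars_noise]) simp
  moreover have "random_variable borel (\<lambda>\<omega>. cond_mean \<rho>\<^sub>1 \<rho>\<^sub>2 s j + noise n j \<omega>)" for j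
    by (rule borel_measurable_add[OF borel_measurable_const measurable_mem[OF noise_mem]])
  ultimately have "distr M (zspace n) (\<lambda>\<omega>. \<lambda>j\<in>{..2 * n}. cond_mean \<rho>\<^sub>1 \<rho>\<^sub>2 s j + noise n j \<omega>) =
      Pi\<^sub>M {..2 * n} (\<lambda>j. distr M borel (\<lambda>\<omega>. cond_mean \<rho>\<^sub>1 \<rho>\<^sub>2 s j + noise n j \<omega>))"
    by (subst (asm) indep_vars_iff_distr_eq_PiM') auto
  also have "\<dots> = transition_law \<rho>\<^sub>1 \<rho>\<^sub>2 (Suc n) s"
    unfolding transition_law_def diff_Suc_1
  proof (rule PiM_cong[OF refl])
    fix j
    show "distr M borel (\<lambda>\<omega>. cond_mean \<rho>\<^sub>1 \<rho>\<^sub>2 s j + noise n j \<omega>) =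
        (if even j then cond_gauss \<rho>\<^sub>1 \<rho>\<^sub>2 s (j div 2) else return borel (s (j + 1)))"
      by (auto simp: noise_def cond_gauss_def distr_add_innov cond_mean_def distr_const)
  qed
  finally show ?thesis by simp
qed

lemma cond_gauss_eq_distr:
  "cond_gauss \<rho>\<^sub>1 \<rho>\<^sub>2 s k = distr M borel (\<lambda>\<omega>. cond_mean \<rho>\<^sub>1 \<rho>\<^sub>2 s (2 * k) + noise n (2 * k) \<omega>)"
  by (simp add: noise_def cond_gauss_def distr_add_innov cond_mean_def)

lemma random_variable_zvec: "random_variable (zspace N) (zvec \<mu> \<xi> N)"
  unfolding zvec_eq[abs_def] by (intro measurable_restrict measurable_mem \<sigma>_mem)

definition step :: "nat \<Rightarrow> (nat \<Rightarrow> real) \<times> (nat \<Rightarrow> real) \<Rightarrow> nat \<Rightarrow> real" where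
  "step n p = (\<lambda>j\<in>{..2 * n}. cond_mean \<rho>\<^sub>1 \<rho>\<^sub>2 (fst p) j + snd p j)"

lemma measurable_step: "step n \<in> zspace (Suc n) \<Otimes>\<^sub>M zspace n \<rightarrow>\<^sub>M zspace n"
  unfolding step_def[abs_def]
proof (intro measurable_restrict borel_measurable_add)
  fix j assume "j \<in> {..2 * n}"
  then show "(\<lambda>p. cond_mean \<rho>\<^sub>1 \<rho>\<^sub>2 (fst p) j) \<in> borel_measurable (zspace (Suc n) \<Otimes>\<^sub>M zspace n)"
    by (intro measurable_compose[OF measurable_fst measurable_cond_mean]) simp
  show "(\<lambda>p. snd p j) \<in> borel_measurable (zspace (Suc n) \<Otimes>\<^sub>M zspace n)"
    using \<open>j \<in> {..2 * n}\<close> by (intro measurable_compose[OF measurable_snd measurable_component_singleton])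
qed

lemma zvec_step: "zvec \<mu> \<xi> n \<omega> = step n (zvec \<mu> \<xi> (Suc n) \<omega>, \<lambda>j\<in>{..2 * n}. noise n j \<omega>)"
  unfolding step_def by (subst zvec_eq_cond_mean_add_noise) (simp cong: restrict_cong)

lemma transition_law_step:
  "transition_law \<rho>\<^sub>1 \<rho>\<^sub>2 (Suc n) s = distr M (zspace n) (\<lambda>\<omega>. step n (s, \<lambda>j\<in>{..2 * n}. noise n j \<omega>))"
  unfolding transition_law_eq_distr step_def by (simp cong: restrict_cong)

lemma regular_cond_distr_zvec:
  "regular_cond_distr M (zalg M \<mu> \<xi> (Suc n)) (zspace n) (zvec \<mu> \<xi> n)
     (\<lambda>\<omega>. transition_law \<rho>\<^sub>1 \<rho>\<^sub>2 (Suc n) (zvec \<mu> \<xi> (Suc n) \<omega>))"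
  unfolding zalg_def
  by (rule regular_cond_distr_freeze[OF indep_generated_zvec_noise measurable_step zvec_step transition_law_step])

lemma real_cond_exp_zvec:
  assumes "r \<in> borel_measurable (zspace n)" "integrable M (\<lambda>\<omega>. r (zvec \<mu> \<xi> n \<omega>))"
  shows "AE \<omega> in M. real_cond_exp M (zalg M \<mu> \<xi> (Suc n)) (\<lambda>\<omega>. r (zvec \<mu> \<xi> n \<omega>)) \<omega> =
    (\<integral>t. r t \<partial>transition_law \<rho>\<^sub>1 \<rho>\<^sub>2 (Suc n) (zvec \<mu> \<xi> (Suc n) \<omega>))"
  unfolding zalg_def
  by (rule real_cond_exp_freeze_kernel[where h = "step n" and X = "zvec \<mu> \<xi> (Suc n)"
        and K = "\<lambda>\<omega>. transition_law \<rho>\<^sub>1 \<rho>\<^sub>2 (Suc n) (zvec \<mu> \<xi> (Suc n) \<omega>)",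
        OF indep_generated_zvec_noise measurable_step zvec_step transition_law_step assms])

lemma regular_cond_distr_zvec_even:
  assumes "k \<le> n"
  shows "regular_cond_distr M (zalg M \<mu> \<xi> (Suc n)) borel (\<lambda>\<omega>. zvec \<mu> \<xi> n \<omega> (2 * k))
     (\<lambda>\<omega>. cond_gauss \<rho>\<^sub>1 \<rho>\<^sub>2 (zvec \<mu> \<xi> (Suc n) \<omega>) k)"
  unfolding zalg_def
proof (rule regular_cond_distr_freeze[OF indep_generated_zvec_noise])
  have k: "2 * k \<in> {..2 * n}" using assms by simp
  show "(\<lambda>p. cond_mean \<rho>\<^sub>1 \<rho>\<^sub>2 (fst p) (2 * k) + snd p (2 * k)) \<in> zspace (Suc n) \<Otimes>\<^sub>M zspace n \<rightarrow>\<^sub>M borel"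
    using measurable_compose[OF measurable_step measurable_component_singleton[OF k]] k by (simp add: step_def)
  show "zvec \<mu> \<xi> n \<omega> (2 * k) = cond_mean \<rho>\<^sub>1 \<rho>\<^sub>2 (fst (zvec \<mu> \<xi> (Suc n) \<omega>, \<lambda>j\<in>{..2 * n}. noise n j \<omega>)) (2 * k) +
      snd (zvec \<mu> \<xi> (Suc n) \<omega>, \<lambda>j\<in>{..2 * n}. noise n j \<omega>) (2 * k)" for \<omega>
    using k by (subst zvec_step) (simp add: step_def)
  show "cond_gauss \<rho>\<^sub>1 \<rho>\<^sub>2 (zvec \<mu> \<xi> (Suc n) \<omega>) k = distr M borel
      (\<lambda>\<omega>'. cond_mean \<rho>\<^sub>1 \<rho>\<^sub>2 (fst (zvec \<mu> \<xi> (Suc n) \<omega>, \<lambda>j\<in>{..2 * n}. noise n j \<omega>')) (2 * k) +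
        snd (zvec \<mu> \<xi> (Suc n) \<omega>, \<lambda>j\<in>{..2 * n}. noise n j \<omega>') (2 * k))" for \<omega>
    unfolding cond_gauss_eq_distr[of _ _ n] using k by simp
qed

lemma cond_indep_vars_zvec_even:
  "cond_indep_vars M (zalg M \<mu> \<xi> (Suc n)) (\<lambda>_. borel) (\<lambda>k \<omega>. zvec \<mu> \<xi> n \<omega> (2 * k)) {..<Suc n}"
  unfolding zalg_def
proof (rule cond_indep_vars_freeze[where Y = "\<lambda>k. noise n (2 * k)"])
  show "indep_generated (zspace (Suc n)) (zvec \<mu> \<xi> (Suc n)) (Pi\<^sub>M {..<Suc n} (\<lambda>_. borel))
      (\<lambda>\<omega>. \<lambda>k\<in>{..<Suc n}. noise n (2 * k) \<omega>)"
    unfolding zvec_eq[abs_def]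
    by (rule indep_generated_\<sigma>_innov[where y = "\<lambda>k. zigzag n (2 * k)"])
      (auto simp: noise_def zigzag_sum)
  show "indep_vars (\<lambda>_. borel) (\<lambda>k. noise n (2 * k)) {..<Suc n}"
  proof (rule indep_vars_if_orthogonal[OF noise_mem])
    fix i j :: nat assume "i \<noteq> j"
    then have "zigzag n (2 * i) \<noteq> zigzag n (2 * j)" by (simp add: zigzag_even)
    then show "expectation (\<lambda>\<omega>. noise n (2 * i) \<omega> * noise n (2 * j) \<omega>) = 0"
      using expectation_innov_innov_eq_0 by (simp add: noise_def)
  qed
  fix k assume "k \<in> {..<Suc n}"
  then have k: "2 * k \<le> 2 * n" by simp
  show "(\<lambda>p. cond_mean \<rho>\<^sub>1 \<rho>\<^sub>2 (fst p) (2 * k) + snd p) \<in> zspace (Suc n) \<Otimes>\<^sub>M borel \<rightarrow>\<^sub>M borel"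
    by (intro borel_measurable_add measurable_snd measurable_compose[OF measurable_fst measurable_cond_mean[OF k]])
  show "zvec \<mu> \<xi> n \<omega> (2 * k) = cond_mean \<rho>\<^sub>1 \<rho>\<^sub>2 (fst (zvec \<mu> \<xi> (Suc n) \<omega>, noise n (2 * k) \<omega>)) (2 * k) +
      snd (zvec \<mu> \<xi> (Suc n) \<omega>, noise n (2 * k) \<omega>)" for \<omega>
    using k by (subst zvec_eq_cond_mean_add_noise) simp
qed

lemma zvec_odd_eq:
  assumes "1 \<le> k" "k \<le> n"
  shows "zvec \<mu> \<xi> n \<omega> (2 * k - 1) = zvec \<mu> \<xi> (Suc n) \<omega> (2 * k)"
proof -
  obtain i where i: "k = Suc i" using assms by (cases k) auto
  have idx: "zigzag n (2 * i + 1) = zigzag (Suc n) (2 * Suc i)"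
    unfolding zigzag_odd zigzag_even by simp
  have "2 * k - 1 = 2 * i + 1" "2 * i + 1 \<le> 2 * n" "2 * Suc i \<le> 2 * Suc n" using assms i by auto
  then show ?thesis
    unfolding zvec_def i by (simp only: restrict_apply' atMost_iff idx)
qed

section \<open>The Markov property of the levels\<close>

text \<open>
  The sites of \<open>\<Delta> n\<close> that do not lie on \<open>\<Gamma> n\<close>; their innovations generate the field on \<open>\<Delta> n\<close> from its
  values on \<open>\<Gamma> n\<close>.
\<close>

definition triangle :: "nat \<Rightarrow> (int \<times> int) set" where
  "triangle n = {x. fst x \<le> 0 \<and> snd x \<le> 0 \<and> - int n < fst x + snd x}"

lemma finite_triangle: "finite (triangle n)"
proof (rule finite_subset)
  show "triangle n \<subseteq> {- int n..0} \<times> {- int n..0}" by (auto simp: triangle_def)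
qed simp

text \<open>
  The filter equation is solved by recursion on the coordinate sum: the field at a site of the
  triangle is its innovation plus a combination of the field at three predecessors in \<open>\<Delta> n\<close> with
  smaller coordinate sum.
\<close>

lemma \<sigma>_eq_function_of_zvec_innov:
  assumes "x \<in> \<Delta> n"
  shows "\<exists>g. g \<in> borel_measurable (zspace n \<Otimes>\<^sub>M Pi\<^sub>M (triangle n) (\<lambda>_. borel)) \<and>
    (\<forall>\<omega>. \<sigma> x \<omega> = g (zvec \<mu> \<xi> n \<omega>, \<lambda>y\<in>triangle n. innov y \<omega>))"
  using assms
proof (induction "nat (fst x + snd x + int n + 1)" arbitrary: x rule: less_induct)
  case less
  let ?P = "zspace n \<Otimes>\<^sub>M Pi\<^sub>M (triangle n) (\<lambda>_. borel :: real measure)"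
  show ?case
  proof (cases "x \<in> \<Gamma> n")
    case True
    then obtain j where j: "j \<le> 2 * n" "x = zigzag n j" by (rule \<Gamma>_eq_zigzag)
    have "(\<lambda>p. fst p j) \<in> borel_measurable ?P"
      using j by (intro measurable_compose[OF measurable_fst measurable_component_singleton]) auto
    then show ?thesis
      using j by (intro exI[of _ "\<lambda>p. fst p j"]) (simp add: zvec_eq)
  next
    case False
    have \<Delta>: "fst x \<le> 0" "snd x \<le> 0" "- int n - 1 \<le> fst x + snd x" using less.prems by (auto simp: mem_\<Delta>_iff)
    have sum: "- int n < fst x + snd x"
      using False less.prems by (auto simp: mem_\<Gamma>_iff mem_\<Delta>_iff)
    have x: "x \<in> triangle n" using sum \<Delta> by (simp add: triangle_def)
    let ?pred = "{(fst x - 1, snd x), (fst x, snd x - 1), (fst x - 1, snd x - 1)}"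
    have "\<forall>y\<in>?pred. \<exists>g. g \<in> borel_measurable ?P \<and> (\<forall>\<omega>. \<sigma> y \<omega> = g (zvec \<mu> \<xi> n \<omega>, \<lambda>y\<in>triangle n. innov y \<omega>))"
      using sum \<Delta> by (intro ballI less.hyps) (auto simp: mem_\<Delta>_iff)
    from bchoice[OF this] obtain g where
      *: "\<forall>y\<in>?pred. g y \<in> borel_measurable ?P \<and> (\<forall>\<omega>. \<sigma> y \<omega> = g y (zvec \<mu> \<xi> n \<omega>, \<lambda>y\<in>triangle n. innov y \<omega>))" ..
    have g: "g y \<in> borel_measurable ?P"
        "\<sigma> y \<omega> = g y (zvec \<mu> \<xi> n \<omega>, \<lambda>y\<in>triangle n. innov y \<omega>)" if "y \<in> ?pred" for y \<omega>
      using bspec[OF * that] by (rule conjunct1, rule conjunct2[THEN spec])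
    define g' where "g' p = snd p x + \<rho>\<^sub>1 * g (fst x - 1, snd x) p + \<rho>\<^sub>2 * g (fst x, snd x - 1) p
        - \<rho>\<^sub>1 * \<rho>\<^sub>2 * g (fst x - 1, snd x - 1) p" for p
    have "(\<lambda>p. snd p x) \<in> borel_measurable ?P"
      using x by (intro measurable_compose[OF measurable_snd measurable_component_singleton]) auto
    then have "g' \<in> borel_measurable ?P"
      unfolding g'_def by (intro borel_measurable_add borel_measurable_diff borel_measurable_times g(1)) auto
    moreover have "\<sigma> x \<omega> = g' (zvec \<mu> \<xi> n \<omega>, \<lambda>y\<in>triangle n. innov y \<omega>)" for \<omega>
    proof -
      have "g' (zvec \<mu> \<xi> n \<omega>, \<lambda>y\<in>triangle n. innov y \<omega>) = innov x \<omega> + \<rho>\<^sub>1 * \<sigma> (fst x - 1, snd x) \<omega>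
          + \<rho>\<^sub>2 * \<sigma> (fst x, snd x - 1) \<omega> - \<rho>\<^sub>1 * \<rho>\<^sub>2 * \<sigma> (fst x - 1, snd x - 1) \<omega>"
        unfolding g'_def using x
        by (simp only: g(2)[of "(fst x - 1, snd x)" \<omega>] g(2)[of "(fst x, snd x - 1)" \<omega>]
            g(2)[of "(fst x - 1, snd x - 1)" \<omega>] insert_iff simp_thms restrict_apply' snd_conv)
      then show ?thesis by (simp add: innov_def)
    qed
    ultimately show ?thesis by blast
  qed
qed

lemma integrable_prod_\<Delta>: "integrable M (\<lambda>\<omega>. \<Prod>x\<in>\<Delta> n. \<xi> x \<omega>)"
  using integrable_prod_affine[OF finite_\<Delta> \<sigma>_mem, where c = "\<lambda>_. \<mu>"] by (simp add: \<sigma>_def)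

lemma prod_\<Delta>_eq_function:
  obtains f where "f \<in> borel_measurable (zspace n \<Otimes>\<^sub>M Pi\<^sub>M (triangle n) (\<lambda>_. borel))"
    "\<And>\<omega>. (\<Prod>x\<in>\<Delta> n. \<xi> x \<omega>) = f (zvec \<mu> \<xi> n \<omega>, \<lambda>y\<in>triangle n. innov y \<omega>)"
proof -
  have "\<forall>x\<in>\<Delta> n. \<exists>g. g \<in> borel_measurable (zspace n \<Otimes>\<^sub>M Pi\<^sub>M (triangle n) (\<lambda>_. borel)) \<and>
      (\<forall>\<omega>. \<sigma> x \<omega> = g (zvec \<mu> \<xi> n \<omega>, \<lambda>y\<in>triangle n. innov y \<omega>))"
    by (rule ballI) (rule \<sigma>_eq_function_of_zvec_innov)
  from bchoice[OF this] obtain g where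
    *: "\<forall>x\<in>\<Delta> n. g x \<in> borel_measurable (zspace n \<Otimes>\<^sub>M Pi\<^sub>M (triangle n) (\<lambda>_. borel)) \<and>
      (\<forall>\<omega>. \<sigma> x \<omega> = g x (zvec \<mu> \<xi> n \<omega>, \<lambda>y\<in>triangle n. innov y \<omega>))" ..
  have g: "g x \<in> borel_measurable (zspace n \<Otimes>\<^sub>M Pi\<^sub>M (triangle n) (\<lambda>_. borel))"
      "\<sigma> x \<omega> = g x (zvec \<mu> \<xi> n \<omega>, \<lambda>y\<in>triangle n. innov y \<omega>)" if "x \<in> \<Delta> n" for x \<omega>
    using bspec[OF * that] by (rule conjunct1, rule conjunct2[THEN spec])
  have "(\<lambda>p. \<Prod>x\<in>\<Delta> n. \<mu> + g x p) \<in> borel_measurable (zspace n \<Otimes>\<^sub>M Pi\<^sub>M (triangle n) (\<lambda>_. borel))"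
    by (intro borel_measurable_prod borel_measurable_add g(1)) auto
  moreover have "(\<Prod>x\<in>\<Delta> n. \<xi> x \<omega>) = (\<Prod>x\<in>\<Delta> n. \<mu> + g x (zvec \<mu> \<xi> n \<omega>, \<lambda>y\<in>triangle n. innov y \<omega>))" for \<omega>
  proof (rule prod.cong[OF refl])
    fix x assume "x \<in> \<Delta> n"
    have "\<xi> x \<omega> = \<mu> + \<sigma> x \<omega>" by (simp add: \<sigma>_def)
    also note g(2)[OF \<open>x \<in> \<Delta> n\<close>, of \<omega>]
    finally show "\<xi> x \<omega> = \<mu> + g x (zvec \<mu> \<xi> n \<omega>, \<lambda>y\<in>triangle n. innov y \<omega>)" .
  qed
  ultimately show thesis by (rule that)
qed

text \<open>
  The innovations on the triangle have coordinate sums above \<open>- n\<close>, while the sites of the levels \<open>n\<close>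
  and \<open>n + 1\<close> have sums at most \<open>- n\<close>. Hence they are independent of both vectors jointly.
\<close>

lemma zvec_markov:
  "AE \<omega> in M. real_cond_exp M (zalg M \<mu> \<xi> (Suc n)) (\<lambda>\<omega>. \<Prod>x\<in>\<Delta> n. \<xi> x \<omega>) \<omega> =
    real_cond_exp M (zalg M \<mu> \<xi> (Suc n)) (real_cond_exp M (zalg M \<mu> \<xi> n) (\<lambda>\<omega>. \<Prod>x\<in>\<Delta> n. \<xi> x \<omega>)) \<omega>"
proof -
  obtain f where f: "f \<in> borel_measurable (zspace n \<Otimes>\<^sub>M Pi\<^sub>M (triangle n) (\<lambda>_. borel))"
    "\<And>\<omega>. (\<Prod>x\<in>\<Delta> n. \<xi> x \<omega>) = f (zvec \<mu> \<xi> n \<omega>, \<lambda>y\<in>triangle n. innov y \<omega>)"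
    by (rule prod_\<Delta>_eq_function) blast
  define S where "S = zigzag n ` {..2 * n} \<union> zigzag (Suc n) ` {..2 * Suc n}"
  have ind: "indep_generated (Pi\<^sub>M S (\<lambda>_. borel)) (\<lambda>\<omega>. \<lambda>x\<in>S. \<sigma> x \<omega>)
      (Pi\<^sub>M (triangle n) (\<lambda>_. borel)) (\<lambda>\<omega>. \<lambda>y\<in>triangle n. innov y \<omega>)"
  proof (rule indep_generated_\<sigma>_innov[where y = "\<lambda>y. y", OF _ finite_triangle])
    fix y assume y: "y \<in> triangle n"
    have "fst x + snd x \<le> - int n" if "x \<in> S" for x
      using that unfolding S_def by (auto simp: zigzag_sum)
    then show "innov y = (\<lambda>_. 0) \<or>
        (innov y = innov y \<and> (\<forall>x\<in>S. fst x + snd x < fst y + snd y))"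
      using y by (force simp: triangle_def)
  qed (simp add: S_def)
  define p where "p N z = (\<lambda>j\<in>{..2 * N}. z (zigzag N j))" for N and z :: "int \<times> int \<Rightarrow> real"
  have p_meas: "p N \<in> Pi\<^sub>M S (\<lambda>_. borel) \<rightarrow>\<^sub>M zspace N" if "zigzag N ` {..2 * N} \<subseteq> S" for N
    unfolding p_def using that by (intro measurable_restrict measurable_component_singleton) auto
  have p_eq: "p N (\<lambda>x\<in>S. \<sigma> x \<omega>) = zvec \<mu> \<xi> N \<omega>" if "zigzag N ` {..2 * N} \<subseteq> S" for N \<omega>
    unfolding p_def zvec_eq using that by (intro restrict_ext) auto
  have sub: "zigzag n ` {..2 * n} \<subseteq> S" "zigzag (Suc n) ` {..2 * Suc n} \<subseteq> S"
    by (auto simp: S_def)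
  have "integrable M (\<lambda>\<omega>. f (p n (\<lambda>x\<in>S. \<sigma> x \<omega>), \<lambda>y\<in>triangle n. innov y \<omega>))"
    unfolding p_eq[OF sub(1)] f(2)[symmetric] by (rule integrable_prod_\<Delta>)
  from real_cond_exp_markov[where p = "p n" and q = "p (Suc n)" and f = f and Z = "\<lambda>\<omega>. \<lambda>x\<in>S. \<sigma> x \<omega>",
      OF ind p_meas[OF sub(1)] p_meas[OF sub(2)] f(1) this]
  show ?thesis
    unfolding p_eq[OF sub(1)] p_eq[OF sub(2)] f(2)[symmetric] zalg_def .
qed

section \<open>Conditional product moments\<close>

lemma sigma_finite_subalgebra_zalg: "sigma_finite_subalgebra M (zalg M \<mu> \<xi> N)"
  unfolding zalg_def by (rule sigma_finite_subalgebra_vimage_algebra[OF random_variable_zvec])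

lemma integrable_cond_moment_function:
  assumes "cond_moment_function M \<mu> \<xi> N r"
  shows "integrable M (\<lambda>\<omega>. r (zvec \<mu> \<xi> N \<omega>))"
proof -
  interpret Z: sigma_finite_subalgebra M "zalg M \<mu> \<xi> N" by (rule sigma_finite_subalgebra_zalg)
  have r: "r \<in> borel_measurable (zspace N)"
    "AE \<omega> in M. r (zvec \<mu> \<xi> N \<omega>) = real_cond_exp M (zalg M \<mu> \<xi> N) (\<lambda>\<omega>. \<Prod>x\<in>\<Delta> N. \<xi> x \<omega>) \<omega>"
    using assms by (auto simp: cond_moment_function_def)
  have "integrable M (real_cond_exp M (zalg M \<mu> \<xi> N) (\<lambda>\<omega>. \<Prod>x\<in>\<Delta> N. \<xi> x \<omega>))"
    by (rule Z.real_cond_exp_int(1)[OF integrable_prod_\<Delta>])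
  moreover have "(\<lambda>\<omega>. r (zvec \<mu> \<xi> N \<omega>)) \<in> borel_measurable M"
    by (rule measurable_compose[OF random_variable_zvec r(1)])
  ultimately show ?thesis
    using r(2) by (subst integrable_cong_AE) auto
qed

lemma measurable_zalg_component:
  assumes "j \<le> 2 * N"
  shows "(\<lambda>\<omega>. zvec \<mu> \<xi> N \<omega> j) \<in> borel_measurable (zalg M \<mu> \<xi> N)"
  unfolding zalg_def
  using assms by (intro measurable_compose[OF measurable_vimage_algebra_self[OF random_variable_zvec] measurable_component_singleton]) auto

text \<open>
  The factors of the product at sites of the zigzag are functions of the vector on which one
  conditions, and can be taken out; the Markov property turns the rest into the previous moment.
\<close>

lemma cond_moment_recurrence:
  assumes R: "cond_moment_function M \<mu> \<xi> (Suc n) R'" and r: "cond_moment_function M \<mu> \<xi> n r"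
  shows "AE \<omega> in M. R' (zvec \<mu> \<xi> (Suc n) \<omega>) =
    real_cond_exp M (zalg M \<mu> \<xi> (Suc n)) (\<lambda>\<omega>. r (zvec \<mu> \<xi> n \<omega>)) \<omega> *
    (\<mu> + zvec \<mu> \<xi> (Suc n) \<omega> 0) * (\<mu> + zvec \<mu> \<xi> (Suc n) \<omega> (2 * Suc n)) *
    (\<Prod>k<Suc n. \<mu> + zvec \<mu> \<xi> (Suc n) \<omega> (2 * k + 1))"
proof -
  let ?F = "zalg M \<mu> \<xi> (Suc n)" and ?Z = "zvec \<mu> \<xi> (Suc n)"
  interpret Z: sigma_finite_subalgebra M ?F by (rule sigma_finite_subalgebra_zalg)
  define Q where "Q \<omega> = (\<mu> + ?Z \<omega> 0) * (\<mu> + ?Z \<omega> (2 * Suc n)) * (\<Prod>k<Suc n. \<mu> + ?Z \<omega> (2 * k + 1))" for \<omega>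
  define P where "P n \<omega> = (\<Prod>x\<in>\<Delta> n. \<xi> x \<omega>)" for n \<omega>
  have component: "\<mu> + ?Z \<omega> j = \<xi> (zigzag (Suc n) j) \<omega>" if "j \<le> 2 * Suc n" for \<omega> j
    using that by (simp add: zvec_def)
  have P_Suc: "P (Suc n) \<omega> = Q \<omega> * P n \<omega>" for \<omega>
  proof -
    have "(\<Prod>k<Suc n. \<mu> + ?Z \<omega> (2 * k + 1)) = (\<Prod>k<Suc n. \<xi> (zigzag (Suc n) (2 * k + 1)) \<omega>)"
      by (intro prod.cong refl component) auto
    then show ?thesis
      unfolding P_def Q_def prod_\<Delta>_Suc by (simp only: component le0 order_refl)
  qed
  have Q_meas: "Q \<in> borel_measurable ?F"
    unfolding Q_def
    by (intro borel_measurable_times borel_measurable_prod borel_measurable_add measurable_zalg_component) auto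
  have P_int: "integrable M (P n)" for n
    unfolding P_def by (rule integrable_prod_\<Delta>)
  have "AE \<omega> in M. real_cond_exp M ?F (\<lambda>\<omega>. Q \<omega> * P n \<omega>) \<omega> = Q \<omega> * real_cond_exp M ?F (P n) \<omega>"
    using P_int[of "Suc n"] P_int[of n] unfolding P_Suc[abs_def]
    by (intro Z.real_cond_exp_mult[OF Q_meas]) auto
  moreover have "AE \<omega> in M. real_cond_exp M ?F (P n) \<omega> =
      real_cond_exp M ?F (real_cond_exp M (zalg M \<mu> \<xi> n) (P n)) \<omega>"
    unfolding P_def by (rule zvec_markov)
  moreover have "AE \<omega> in M. real_cond_exp M ?F (\<lambda>\<omega>. r (zvec \<mu> \<xi> n \<omega>)) \<omega> =
      real_cond_exp M ?F (real_cond_exp M (zalg M \<mu> \<xi> n) (P n)) \<omega>"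
    using r integrable_cond_moment_function[OF r] unfolding P_def
    by (intro Z.real_cond_exp_cong) (auto simp: cond_moment_function_def)
  moreover have "AE \<omega> in M. R' (?Z \<omega>) = real_cond_exp M ?F (\<lambda>\<omega>. Q \<omega> * P n \<omega>) \<omega>"
    using R unfolding P_Suc[symmetric] by (simp add: cond_moment_function_def P_def)
  ultimately show ?thesis
    by eventually_elim (simp add: Q_def)
qed

text \<open>
  The identity holds almost surely for \<open>s = \<sigma> (0, 0)\<close>. This variable is standard normal, and its
  density is positive everywhere, so it also holds almost everywhere for Lebesgue measure.
\<close>

lemma cond_moment_initial:
  assumes "cond_moment_function M \<mu> \<xi> 0 r"
  shows "AE s in lborel. r (\<lambda>j\<in>{..0}. s) = \<mu> + s"
proof -
  interpret Z: sigma_finite_subalgebra M "zalg M \<mu> \<xi> 0" by (rule sigma_finite_subalgebra_zalg)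
  have \<Delta>0: "\<Delta> 0 = {(0, 0)}"
    by (auto simp: mem_\<Delta>_iff prod_eq_iff)
  have zvec0: "zvec \<mu> \<xi> 0 \<omega> = (\<lambda>j\<in>{..0}. \<sigma> (0, 0) \<omega>)" for \<omega>
    by (auto simp: zvec_eq zigzag_def fun_eq_iff)
  have r: "r \<in> borel_measurable (zspace 0)"
    "AE \<omega> in M. r (\<lambda>j\<in>{..0}. \<sigma> (0, 0) \<omega>) = real_cond_exp M (zalg M \<mu> \<xi> 0) (\<lambda>\<omega>. \<xi> (0, 0) \<omega>) \<omega>"
    using assms unfolding cond_moment_function_def \<Delta>0 zvec0 by auto
  have "(\<lambda>\<omega>. \<mu> + zvec \<mu> \<xi> 0 \<omega> 0) \<in> borel_measurable (zalg M \<mu> \<xi> 0)"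
    by (intro borel_measurable_add measurable_zalg_component) auto
  then have "(\<lambda>\<omega>. \<xi> (0, 0) \<omega>) \<in> borel_measurable (zalg M \<mu> \<xi> 0)"
    by (simp add: zvec0 \<sigma>_def)
  then have "AE \<omega> in M. real_cond_exp M (zalg M \<mu> \<xi> 0) (\<lambda>\<omega>. \<xi> (0, 0) \<omega>) \<omega> = \<xi> (0, 0) \<omega>"
    by (rule Z.real_cond_exp_F_meas[OF integrable_\<xi>])
  with r(2) have AE_M: "AE \<omega> in M. r (\<lambda>j\<in>{..0}. \<sigma> (0, 0) \<omega>) = \<mu> + \<sigma> (0, 0) \<omega>"
    by eventually_elim (simp add: \<sigma>_def)
  define k where "k s = r (\<lambda>j\<in>{..0}. s)" for s
  have [measurable]: "k \<in> borel_measurable borel"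
    unfolding k_def by (rule measurable_compose[OF _ r(1)]) (auto intro!: measurable_restrict)
  have [measurable]: "random_variable borel (\<sigma> (0, 0))" by (rule measurable_mem[OF \<sigma>_mem])
  have "distributed M lborel (\<sigma> (0, 0)) (normal_density 0 1)"
    by (rule distributed_mem[OF \<sigma>_mem]) (simp_all add: expectation_\<sigma>_\<sigma>)
  then have law: "distr M lborel (\<sigma> (0, 0)) = density lborel (normal_density 0 1)"
    by (simp add: distributed_def)
  have "AE s in distr M lborel (\<sigma> (0, 0)). k s = \<mu> + s"
    using AE_M unfolding k_def[symmetric] by (subst AE_distr_iff) auto
  then show ?thesis
    unfolding law k_def[symmetric] by (subst (asm) AE_density) (auto simp: normal_density_pos)
qed

end

theorem theorem7p1:
  fixes M :: "'a measure"
    and \<beta> V \<alpha>\<^sub>1 \<alpha>\<^sub>2 \<mu> \<rho>\<^sub>1 \<rho>\<^sub>2 :: real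
    and \<xi> :: "int \<times> int \<Rightarrow> 'a \<Rightarrow> real"
    and R :: "nat \<Rightarrow> (nat \<Rightarrow> real) \<Rightarrow> real"
  assumes "prob_space M"
    and "\<beta> > 0" and "\<alpha>\<^sub>1 > 0" and "\<alpha>\<^sub>2 > 0"
    and "\<mu> = exp (- (\<beta> * V))"
    and "\<rho>\<^sub>1 = exp (- (\<alpha>\<^sub>1 * \<beta>))" and "\<rho>\<^sub>2 = exp (- (\<alpha>\<^sub>2 * \<beta>))"
    and "pickard_field M \<mu> \<rho>\<^sub>1 \<rho>\<^sub>2 \<xi>"
    and "\<forall>N. cond_moment_function M \<mu> \<xi> N (R N)"
  shows "(AE s in lborel. R 0 (\<lambda>j\<in>{..0}. s) = \<mu> + s) \<and>
    (\<forall>N>0.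
      (AE \<omega> in M. R N (zvec \<mu> \<xi> N \<omega>) =
         real_cond_exp M (zalg M \<mu> \<xi> N) (\<lambda>\<omega>'. R (N - 1) (zvec \<mu> \<xi> (N - 1) \<omega>')) \<omega> *
         (\<mu> + zvec \<mu> \<xi> N \<omega> 0) * (\<mu> + zvec \<mu> \<xi> N \<omega> (2 * N)) *
         (\<Prod>k<N. \<mu> + zvec \<mu> \<xi> N \<omega> (2 * k + 1))) \<and>
      (AE \<omega> in M.
         real_cond_exp M (zalg M \<mu> \<xi> N) (\<lambda>\<omega>'. R (N - 1) (zvec \<mu> \<xi> (N - 1) \<omega>')) \<omega> =
         (\<integral>t. R (N - 1) t \<partial>transition_law \<rho>\<^sub>1 \<rho>\<^sub>2 N (zvec \<mu> \<xi> N \<omega>))) \<and>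
      regular_cond_distr M (zalg M \<mu> \<xi> N) (zspace (N - 1)) (zvec \<mu> \<xi> (N - 1))
        (\<lambda>\<omega>. transition_law \<rho>\<^sub>1 \<rho>\<^sub>2 N (zvec \<mu> \<xi> N \<omega>)) \<and>
      (\<forall>\<omega>\<in>space M. \<forall>k. 1 \<le> k \<and> k < N \<longrightarrow>
         zvec \<mu> \<xi> (N - 1) \<omega> (2 * k - 1) = zvec \<mu> \<xi> N \<omega> (2 * k)) \<and>
      cond_indep_vars M (zalg M \<mu> \<xi> N) (\<lambda>_. borel)
        (\<lambda>k \<omega>. zvec \<mu> \<xi> (N - 1) \<omega> (2 * k)) {..<N} \<and>
      (\<forall>k<N. regular_cond_distr M (zalg M \<mu> \<xi> N) borel
        (\<lambda>\<omega>. zvec \<mu> \<xi> (N - 1) \<omega> (2 * k))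
        (\<lambda>\<omega>. cond_gauss \<rho>\<^sub>1 \<rho>\<^sub>2 (zvec \<mu> \<xi> N \<omega>) k)))"
proof -
  interpret prob_space M by fact
  interpret pickard M \<mu> \<rho>\<^sub>1 \<rho>\<^sub>2 \<xi>
  proof
    show "0 < \<rho>\<^sub>1" "\<rho>\<^sub>1 < 1" "0 < \<rho>\<^sub>2" "\<rho>\<^sub>2 < 1"
      using assms by auto
  qed fact
  have R: "cond_moment_function M \<mu> \<xi> N (R N)" for N
    using assms(9) by blast
  have R_meas: "R N \<in> borel_measurable (zspace N)" for N
    using R by (simp add: cond_moment_function_def)
  show ?thesis
  proof (intro conjI allI impI ballI, goal_cases)
    case 1
    show ?case by (rule cond_moment_initial[OF R])
  next
    case (2 N)
    then obtain n where "N = Suc n" by (cases N) auto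
    then show ?case using cond_moment_recurrence[OF R R, of n] by simp
  next
    case (3 N)
    then obtain n where "N = Suc n" by (cases N) auto
    then show ?case using real_cond_exp_zvec[OF R_meas integrable_cond_moment_function[OF R], of n] by simp
  next
    case (4 N)
    then obtain n where "N = Suc n" by (cases N) auto
    then show ?case using regular_cond_distr_zvec[of n] by simp
  next
    case (5 N \<omega> k)
    then obtain n where "N = Suc n" by (cases N) auto
    then show ?case using zvec_odd_eq[of k n] 5 by simp
  next
    case (6 N)
    then obtain n where "N = Suc n" by (cases N) auto
    then show ?case using cond_indep_vars_zvec_even[of n] by simp
  next
    case (7 N k)
    then obtain n where "N = Suc n" by (cases N) auto
    then show ?case using regular_cond_distr_zvec_even[of k n] 7 by simp
  qed
qed

end
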